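(* Let $\Lambda = \{\lambda_{1}, \dots ,\lambda_{m}\}\subset \mathbb{Z}^{+}$ with $1\le \lambda_{1} < \dots < \lambda_{m}$, let $\underline{\lambda} = (\lambda_{1}, \dots ,\lambda_{m})$, and let $A$ be a proper subset of $\mathbb{N}$. Then $R_{A,\underline{\lambda}}(n) = 1$ for every nonnegative integer $n$ if and only if there exist an integer $\lambda \ge 2$, an integer $k\ge 1$ and integers $u_{1}, v_{1}, u_{2}, v_{2}, \dots ,u_{k-1}, v_{k-1}, u_{k} \ge 2$ such that \[ \Lambda = \Lambda_{\lambda}(u_{1}, v_{1}, u_{2}, v_{2}, \dots ,u_{k-1}, v_{k-1}, u_{k}) \quad\text{and}\quad A = A_{\lambda}(u_{1}, v_{1}, u_{2}, v_{2}, \dots ,u_{k-1}, v_{k-1}, u_{k}, \infty). \]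
   Context: $\mathbb{N}$ is the set of nonnegative integers and $\mathbb{Z}^{+}$ the set of positive integers. For $A\subseteq\mathbb{N}$ and a tuple $\underline{\lambda}=(\lambda_1,\dots,\lambda_m)$ of positive integers, \[ R_{A,\underline{\lambda}}(n) = |\{(a_{1}, \dots ,a_{m})\in A^{m}: \lambda_{1}a_{1} + \dots + \lambda_{m}a_{m} = n\}|. \] For positive integers $u_1,u_2,\dots,v_1,v_2,\dots$ put $U_i=u_1u_2\cdots u_i$, $V_i=v_1v_2\cdots v_i$ (with $U_0=V_0=1$). For $k\ge 1$ define \[ S(u_{1}, v_{1}, \dots ,u_{k-1}, v_{k-1}, u_{k}) = \Big\{\sum_{h=0}^{k-1} i_h U_hV_h: 0\le i_{h} < u_{h+1},\ h = 0,1, \dots ,k-1\Big\}, \] \[ T(u_{1}, v_{1}, \dots ,u_{k-1},v_{k-1},u_{k}, \infty) = \Big\{\sum_{h=0}^{k-1} j_h U_{h+1}V_h: 0\le j_{h} < v_{h+1}\text{ for } h = 0,1, \dots ,k-2,\ j_{k-1}\in \mathbb{N}\Big\}, \] where all $i_h,j_h$ are integers (for $k=1$ these are $S(u_1)=\{0,1,\dots,u_1-1\}$ and $T(u_1,\infty)=\{j_0u_1: j_0\in\mathbb{N}\}$). For an integer $\lambda\ge 2$ define \[ \Lambda_{\lambda}(u_{1}, v_{1}, \dots ,u_{k-1}, v_{k-1}, u_{k}) = \{\lambda^{s}: s\in S(u_{1}, v_{1}, \dots ,u_{k-1}, v_{k-1}, u_{k})\}, \] \[ A_{\lambda}(u_{1},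 v_{1}, \dots ,u_{k-1},v_{k-1},u_{k}, \infty) = \Big\{\sum_{t\in T(u_{1}, v_{1}, \dots ,u_{k}, \infty)}\delta_{t}\lambda^{t}: 0\le \delta_{t} < \lambda \Big\}, \] where the $\delta_t$ are integers, only finitely many of which are nonzero. *)

theory Defs
  imports Main "HOL-Library.FuncSet"
begin

text \<open>Tuples \<open>(x\<^sub>1, \<dots>, x\<^sub>m)\<close> are functions on the index set \<open>{1..m}\<close>; tuples of summands are
  taken extensional (\<open>\<rightarrow>\<^sub>E\<close>), so that they can be counted. If all \<open>lam i\<close> are positive, the
  counted set is finite, hence \<open>card\<close> has its usual meaning.\<close>

definition rep_count :: "nat set \<Rightarrow> nat \<Rightarrow> (nat \<Rightarrow> nat) \<Rightarrow> nat \<Rightarrow> nat" where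
  "rep_count A m lam n = card {a \<in> {1..m} \<rightarrow>\<^sub>E A. (\<Sum>i=1..m. lam i * a i) = n}"

definition partial_prod :: "(nat \<Rightarrow> nat) \<Rightarrow> nat \<Rightarrow> nat" where
  "partial_prod w i = (\<Prod>j=1..i. w j)"

text \<open>The parameter list \<open>u\<^sub>1, v\<^sub>1, \<dots>, u\<^bsub>k-1\<^esub>, v\<^bsub>k-1\<^esub>, u\<^sub>k\<close> is given by \<open>k\<close> and two functions;
  only \<open>u 1, \<dots>, u k\<close> and \<open>v 1, \<dots>, v (k - 1)\<close> enter the definitions below.\<close>

definition S_set :: "nat \<Rightarrow> (nat \<Rightarrow> nat) \<Rightarrow> (nat \<Rightarrow> nat) \<Rightarrow> nat set" where
  "S_set k u v =
    {(\<Sum>h<k. c h * partial_prod u h * partial_prod v h) | c. \<forall>h<k. c h < u (h + 1)}"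

text \<open>The last digit \<open>c (k - 1)\<close> is unrestricted.\<close>

definition T_set :: "nat \<Rightarrow> (nat \<Rightarrow> nat) \<Rightarrow> (nat \<Rightarrow> nat) \<Rightarrow> nat set" where
  "T_set k u v =
    {(\<Sum>h<k. c h * partial_prod u (h + 1) * partial_prod v h) | c.
       \<forall>h. h + 1 < k \<longrightarrow> c h < v (h + 1)}"

definition Lambda_set :: "nat \<Rightarrow> nat \<Rightarrow> (nat \<Rightarrow> nat) \<Rightarrow> (nat \<Rightarrow> nat) \<Rightarrow> nat set" where
  "Lambda_set l k u v = {l ^ s | s. s \<in> S_set k u v}"

text \<open>\<open>T_set k u v\<close> may be infinite, and \<open>sum\<close> over an infinite set is \<open>0\<close>; the sum is
  therefore taken over the finite support of the digit function \<open>d\<close>.\<close>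

definition A_set :: "nat \<Rightarrow> nat \<Rightarrow> (nat \<Rightarrow> nat) \<Rightarrow> (nat \<Rightarrow> nat) \<Rightarrow> nat set" where
  "A_set l k u v =
    {(\<Sum>t\<in>{t \<in> T_set k u v. d t \<noteq> 0}. d t * l ^ t) | d.
       (\<forall>t\<in>T_set k u v. d t < l) \<and> finite {t \<in> T_set k u v. d t \<noteq> 0}}"

end

theory Submission
  imports Defs
begin

text \<open>Unique representability says that \<open>\<nat>\<close> is the direct sum of the sets \<open>l \<cdot> A\<close>, \<open>l \<in> \<Lambda>\<close>.
  De Bruijn's block argument applies to any direct decomposition \<open>\<nat> = X \<oplus> Y\<close> with \<open>1 \<in> X\<close>: if \<open>g\<close> is
  the least positive element of \<open>Y\<close>, then \<open>Y\<close> consists of multiples of \<open>g\<close> and \<open>X\<close> is a union of blocks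
  \<open>{q g, \<dots>, q g + g - 1}\<close>. At level 0 this gives \<open>b = g \<in> \<Lambda>\<close>. Dividing the multiples of \<open>b\<close> by \<open>b\<close>
  repeatedly, one sees by induction that at every level \<open>t\<close> exactly one summand contains \<open>b\<^sup>t\<close>, that it
  has full blocks of length \<open>b\<close>, and that all other summands are multiples of \<open>b\<close>. Hence all elements of
  \<open>\<Lambda>\<close> are powers \<open>b\<^sup>s\<close>, \<open>A\<close> is given by a set \<open>T\<close> of free digit positions in base \<open>b\<close>, and the exponents
  satisfy \<open>S \<oplus> T = \<nat>\<close> with \<open>S\<close> finite. Peeling off blocks alternately from \<open>S\<close> and \<open>T\<close> yields the parameters
  \<open>u\<^sub>1, v\<^sub>1, u\<^sub>2, \<dots>\<close>. Conversely, \<open>S \<oplus> T = \<nat>\<close> distributes the digit positions among the summands.\<close>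

section \<open>Complementary pairs of sets\<close>

definition complementary :: "nat set \<Rightarrow> nat set \<Rightarrow> bool" where
  "complementary X Y \<longleftrightarrow> (\<forall>n. \<exists>x\<in>X. \<exists>y\<in>Y. n = x + y) \<and>
     (\<forall>x\<in>X. \<forall>x'\<in>X. \<forall>y\<in>Y. \<forall>y'\<in>Y. x + y = x' + y' \<longrightarrow> x = x')"

lemma complementaryE:
  assumes "complementary X Y"
  obtains x y where "x \<in> X" "y \<in> Y" "n = x + y"
  using assms unfolding complementary_def by blast

lemma complementary_unique:
  assumes "complementary X Y" "x \<in> X" "x' \<in> X" "y \<in> Y" "y' \<in> Y" "x + y = x' + y'"
  shows "x = x'" "y = y'"
proof -
  show "x = x'"
    using assms unfolding complementary_def by blast
  then show "y = y'"
    using assms(6) by simp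
qed

lemma complementary_sym:
  assumes "complementary X Y"
  shows "complementary Y X"
  unfolding complementary_def
proof (intro conjI allI ballI impI)
  fix n
  obtain x y where "x \<in> X" "y \<in> Y" "n = x + y"
    by (rule complementaryE[OF assms])
  then show "\<exists>x\<in>Y. \<exists>y\<in>X. n = x + y"
    by (metis add.commute)
next
  fix x x' y y'
  assume "x \<in> Y" "x' \<in> Y" "y \<in> X" "y' \<in> X" "x + y = x' + y'"
  then show "x = x'"
    using complementary_unique(2)[OF assms, of y y' x x'] by (simp add: add.commute)
qed

lemma complementary_zero:
  assumes "complementary X Y"
  shows "0 \<in> X" "0 \<in> Y"
  by (rule complementaryE[OF assms, of 0]; simp)+

lemma complementary_disjoint:
  assumes "complementary X Y" "x \<in> X" "x \<in> Y"
  shows "x = 0"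
proof -
  note zero = complementary_zero[OF assms(1)]
  show ?thesis
    by (rule complementary_unique(1)[OF assms(1,2) zero(1) zero(2) assms(3)]) simp
qed

text \<open>Strong induction over the blocks of \<open>g\<close> numbers with quotient
  \<open>q\<close>. For \<open>q > 0\<close>, the structure of earlier blocks makes it independent
  of the residue whether a number of block \<open>q\<close> is a sum from earlier blocks. If it is,
  the block misses \<open>X\<close> and \<open>Y\<close>; if not, \<open>q * g\<close> lies in
  \<open>X\<close> or \<open>Y\<close>, which decides the whole block.\<close>

lemma complementary_blocks_aux:
  assumes XY: "complementary X Y" and g: "g \<in> Y" "g > 0" and min: "\<And>y. y \<in> Y \<Longrightarrow> 0 < y \<Longrightarrow> g \<le> y"
  shows "(\<forall>y\<in>Y. y div g = q \<longrightarrow> y = q * g) \<and> (\<forall>x. x div g = q \<longrightarrow> (x \<in> X \<longleftrightarrow> q * g \<in> X))"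
proof (induction q rule: less_induct)
  case (less q)
  note zero = complementary_zero[OF XY]
  have small: "x \<in> X" if "x < g" for x
  proof -
    obtain x' y' where xy: "x' \<in> X" "y' \<in> Y" "x = x' + y'"
      by (rule complementaryE[OF XY])
    then have "y' = 0"
      using min[of y'] that by force
    with xy show ?thesis by simp
  qed
  show ?case
  proof (cases "q = 0")
    case True
    have "y = 0" if "y \<in> Y" "y div g = 0" for y
      using min[OF that(1)] that(2) g(2) by (cases y) (auto simp: div_eq_0_iff)
    moreover have "x \<in> X" if "x div g = 0" for x
      using small that g(2) by (simp add: div_eq_0_iff)
    ultimately show ?thesis
      using True zero by auto
  next
    case q: False
    have block: "q * g + n mod g = n" if "n div g = q" for n
      using that by (metis div_mult_mod_eq)
    \<comment> \<open>A representation of \<open>n\<close> is carried over to \<open>n'\<close> by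
      exchanging the residue of \<open>x\<close>; \<open>y\<close> is a multiple of \<open>g\<close>
      and stays.\<close>
    have cover: "\<exists>x'\<in>X. \<exists>y\<in>Y. n' = x' + y \<and> x' div g < q \<and> y div g < q"
      if n: "n div g = q" "n' div g = q" and xy: "x \<in> X" "y \<in> Y" "n = x + y" "x div g < q" "y div g < q"
      for n n' x y
    proof -
      define x' where "x' = x div g * g + n' mod g"
      have x'div: "x' div g = x div g"
        unfolding x'_def using g(2) by simp
      have "x' \<in> X"
        using less[OF xy(4)] xy(1) x'div by blast
      moreover have "n' = x' + y"
      proof -
        have y: "y = y div g * g"
          using less[OF xy(5)] xy(2) by blast
        have "n mod g = x mod g"
          using xy(3) y by (metis mod_mult_self1 mult.commute)
        then have "n = x div g * g + n mod g + y"
          using xy(3) by (metis div_mult_mod_eq)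
        then show ?thesis
          using block[OF n(1)] block[OF n(2)] unfolding x'_def by linarith
      qed
      ultimately show ?thesis
        using xy x'div by metis
    qed
    have qdiv: "q * g div g = q"
      using g(2) by simp
    show ?thesis
    proof (cases "\<exists>x\<in>X. \<exists>y\<in>Y. q * g = x + y \<and> x div g < q \<and> y div g < q")
      case True
      have "n \<notin> X \<and> n \<notin> Y" if "n div g = q" for n
      proof -
        obtain x y where xy: "x \<in> X" "y \<in> Y" "n = x + y" "x div g < q" "y div g < q"
        proof -
          obtain x y where "x \<in> X" "y \<in> Y" "q * g = x + y" "x div g < q" "y div g < q"
            using True by blast
          from cover[OF qdiv \<open>n div g = q\<close> this] show ?thesis
            using that by blast
        qed
        show ?thesis
        proof (intro conjI notI)
          assume "n \<in> X"
          then have "x = n"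
            using complementary_unique(1)[OF XY xy(1) _ xy(2) zero(2), of n] xy(3)[symmetric] by simp
          then show False
            using xy(4) that by simp
        next
          assume "n \<in> Y"
          then have "y = n"
            using complementary_unique(2)[OF XY xy(1) zero(1) xy(2), of n] xy(3)[symmetric] by simp
          then show False
            using xy(5) that by simp
        qed
      qed
      then show ?thesis
        using qdiv by blast
    next
      case False
      \<comment> \<open>When sums from earlier blocks do not reach block \<open>q\<close>, one
        summand lies in the block itself, which leaves less than \<open>g\<close> for the
        other.\<close>
      have top: "x div g = q \<and> y < g \<or> y div g = q \<and> x < g"
        if n: "n div g = q" and xy: "x \<in> X" "y \<in> Y" "n = x + y" for n x y
      proof -
        have "\<not> (x div g < q \<and> y div g < q)"
          using cover[OF n qdiv xy] False by auto
        moreover have "x div g \<le> q" "y div g \<le> q"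
          using n xy(3) by (auto intro: div_le_mono)
        ultimately have "x div g = q \<or> y div g = q"
          by linarith
        moreover have "n < q * g + g"
          using block[OF n] mod_less_divisor[OF g(2), of n] by linarith
        moreover have "q * g \<le> x" if "x div g = q" for x
          using block[OF that] by linarith
        ultimately show ?thesis
          using xy(3) by (metis add.commute add_le_cancel_left leD leI le_trans)
      qed
      obtain x y where xy: "x \<in> X" "y \<in> Y" "q * g = x + y"
        by (rule complementaryE[OF XY])
      from top[OF qdiv xy] show ?thesis
      proof (elim disjE conjE)
        assume "x div g = q" "y < g"
        then have qX: "q * g \<in> X"
          using block[of x] xy by (metis le_add1 le_antisym)
        have nY: "n \<notin> Y" if n: "n div g = q" for n
        proof
          assume "n \<in> Y"
          show False
          proof (cases "n mod g = 0")
            case True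
            then show False
              using complementary_disjoint[OF XY qX] block[OF n] \<open>n \<in> Y\<close> q g(2) by simp
          next
            case False
            then have "g - n mod g \<in> X"
              using small g(2) by simp
            \<comment> \<open>The number \<open>q * g + g\<close> would have a second
              representation.\<close>
            moreover have "q * g + g = g - n mod g + n"
              using block[OF n] g(2) mod_less_divisor[OF g(2), of n] by linarith
            ultimately have "q * g = g - n mod g"
              using complementary_unique(1)[OF XY qX _ g(1) \<open>n \<in> Y\<close>] by blast
            moreover have "g \<le> q * g"
              using q by simp
            ultimately show False
              using False g(2) by linarith
          qed
        qed
        have "n \<in> X" if n: "n div g = q" for n
        proof -
          obtain x y where xy: "x \<in> X" "y \<in> Y" "n = x + y"
            by (rule complementaryE[OF XY])
          then have "y < g"
            using top[OF n xy] nY by blast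
          then have "y = 0"
            using min xy(2) by force
          then show ?thesis
            using xy by simp
        qed
        then show ?thesis
          using nY qX by blast
      next
        assume "y div g = q" "x < g"
        then have qY: "q * g \<in> Y"
          using block[of y] xy by (metis le_add1 le_add2 le_antisym)
        \<comment> \<open>The representation of \<open>n\<close> as \<open>n mod g\<close> plus
          \<open>q * g\<close> excludes \<open>n + 0\<close>, and also \<open>0 + n\<close> unless
          \<open>n = q * g\<close>.\<close>
        have n: "n \<notin> X \<and> (n \<in> Y \<longrightarrow> n = q * g)" if n: "n div g = q" for n
        proof -
          have r: "n mod g \<in> X"
            using small g(2) by simp
          have "n \<notin> X"
            using complementary_unique(2)[OF XY r _ qY zero(2), of n] block[OF n] q g(2) by auto
          moreover have "n = q * g" if "n \<in> Y"
            using complementary_unique(2)[OF XY r zero(1) qY that] block[OF n] by simp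
          ultimately show ?thesis by blast
        qed
        then show ?thesis
          using qdiv by blast
      qed
    qed
  qed
qed

lemma complementary_blocks:
  assumes "complementary X Y" "g \<in> Y" "g > 0" "\<And>y. y \<in> Y \<Longrightarrow> 0 < y \<Longrightarrow> g \<le> y"
  shows "y \<in> Y \<Longrightarrow> g dvd y" "x \<in> X \<longleftrightarrow> g * (x div g) \<in> X"
proof -
  show "g dvd y" if "y \<in> Y"
    using complementary_blocks_aux[OF assms, of "y div g"] that by (metis dvd_triv_right)
  show "x \<in> X \<longleftrightarrow> g * (x div g) \<in> X"
    using complementary_blocks_aux[OF assms, of "x div g"] unfolding mult.commute[of g] by blast
qed

lemma complementary_quotient:
  assumes XY: "complementary X Y" and d: "d > 0" "\<And>y. y \<in> Y \<Longrightarrow> d dvd y"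
  shows "complementary {x. d * x \<in> X} {y. d * y \<in> Y}"
  unfolding complementary_def
proof (intro conjI allI ballI impI)
  fix n
  obtain x y where xy: "x \<in> X" "y \<in> Y" "d * n = x + y"
    by (rule complementaryE[OF XY])
  then obtain y' where y': "y = d * y'"
    using d(2) by blast
  moreover have "d dvd x"
    using xy(3) d(2)[OF xy(2)] by (metis dvd_add_left_iff dvd_triv_left)
  then obtain x' where x': "x = d * x'" by blast
  ultimately have "n = x' + y'"
    using xy(3) d(1) by (metis distrib_left mult_left_cancel not_gr0)
  then show "\<exists>x\<in>{x. d * x \<in> X}. \<exists>y\<in>{y. d * y \<in> Y}. n = x + y"
    using xy x' y' by blast
next
  fix x x' y y'
  assume h: "x \<in> {x. d * x \<in> X}" "x' \<in> {x. d * x \<in> X}" "y \<in> {y. d * y \<in> Y}" "y' \<in> {y. d * y \<in> Y}"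
    "x + y = x' + y'"
  then have "d * x + d * y = d * x' + d * y'"
    by (metis distrib_left)
  then show "x = x'"
    using complementary_unique(1)[OF XY, of "d * x" "d * x'" "d * y" "d * y'"] h d(1) by simp
qed

section \<open>Direct sum decompositions\<close>

definition tiles :: "'i set \<Rightarrow> ('i \<Rightarrow> nat set) \<Rightarrow> bool" where
  "tiles I X \<longleftrightarrow> (\<forall>n. \<exists>!f. f \<in> Pi\<^sub>E I X \<and> sum f I = n)"

lemma tilesE:
  assumes "tiles I X"
  obtains f where "f \<in> Pi\<^sub>E I X" "sum f I = n"
  using assms unfolding tiles_def by blast

lemma tiles_unique:
  assumes "tiles I X" "f \<in> Pi\<^sub>E I X" "f' \<in> Pi\<^sub>E I X" "sum f I = sum f' I"
  shows "f = f'"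
  using assms unfolding tiles_def by metis

lemma tiles_zero:
  assumes "tiles I X" "finite I" "i \<in> I"
  shows "0 \<in> X i"
proof -
  obtain f where "f \<in> Pi\<^sub>E I X" "sum f I = 0"
    by (rule tilesE[OF assms(1)])
  then show ?thesis
    using assms(2,3) by (metis PiE_mem sum_eq_0_iff)
qed

text \<open>Merging all summands but one into their sumset gives a pair, to which the block lemma
  applies.\<close>

lemma tiles_complementary:
  assumes t: "tiles I X" and I: "finite I" "i \<in> I"
  shows "complementary (X i) ((\<lambda>f. sum f (I - {i})) ` Pi\<^sub>E (I - {i}) X)" (is "complementary _ ?Y")
  unfolding complementary_def
proof (intro conjI allI ballI impI)
  fix n
  obtain f where f: "f \<in> Pi\<^sub>E I X" "sum f I = n"
    by (rule tilesE[OF t])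
  have "sum f (I - {i}) = sum (restrict f (I - {i})) (I - {i})"
    by (rule sum.cong) auto
  moreover have "restrict f (I - {i}) \<in> Pi\<^sub>E (I - {i}) X"
    using f(1) by auto
  ultimately have "sum f (I - {i}) \<in> ?Y" by blast
  moreover have "n = f i + sum f (I - {i})"
    using f(2) I by (metis sum.remove)
  ultimately show "\<exists>x\<in>X i. \<exists>y\<in>?Y. n = x + y"
    using f(1) I(2) by blast
next
  fix x x' y y'
  assume x: "x \<in> X i" "x' \<in> X i" and y: "y \<in> ?Y" "y' \<in> ?Y" and eq: "x + y = x' + y'"
  obtain f f' where f: "f \<in> Pi\<^sub>E (I - {i}) X" "y = sum f (I - {i})"
    "f' \<in> Pi\<^sub>E (I - {i}) X" "y' = sum f' (I - {i})"
    using y by blast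
  have upd: "h(i := z) \<in> Pi\<^sub>E I X \<and> sum (h(i := z)) I = z + sum h (I - {i})"
    if "h \<in> Pi\<^sub>E (I - {i}) X" "z \<in> X i" for h z
  proof
    show "h(i := z) \<in> Pi\<^sub>E I X"
      using that I(2) by (auto simp: PiE_def Pi_def extensional_def)
    have "sum (h(i := z)) (I - {i}) = sum h (I - {i})"
      by (rule sum.cong) auto
    then show "sum (h(i := z)) I = z + sum h (I - {i})"
      using sum.remove[OF I, of "h(i := z)"] by simp
  qed
  have "f(i := x) = f'(i := x')"
    using tiles_unique[OF t] upd f x eq by metis
  then show "x = x'"
    by (metis fun_upd_same)
qed

text \<open>Every summand contains 0, so an element of one summand is the sum of a family that
  vanishes elsewhere.\<close>

lemma tiles_member_rest:
  assumes t: "tiles I X" and I: "finite I" "j \<in> I" "j \<noteq> i" and x: "x \<in> X j"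
  shows "x \<in> (\<lambda>f. sum f (I - {i})) ` Pi\<^sub>E (I - {i}) X"
proof -
  let ?f = "\<lambda>k. if k \<in> I - {i} then (if k = j then x else 0) else undefined"
  have "?f \<in> Pi\<^sub>E (I - {i}) X"
    using tiles_zero[OF t I(1)] x by (auto simp: PiE_def Pi_def extensional_def)
  moreover have "sum ?f (I - {i}) = (\<Sum>k\<in>I - {i}. if k = j then x else 0)"
    by (rule sum.cong) auto
  then have "sum ?f (I - {i}) = x"
    using I by simp
  ultimately show ?thesis
    by (metis (no_types, lifting) image_eqI)
qed

lemma tiles_disjoint:
  assumes "tiles I X" "finite I" "i \<in> I" "j \<in> I" "x \<in> X i" "x \<in> X j" "x > 0"
  shows "i = j"
proof (rule ccontr)
  assume "i \<noteq> j"
  then have "x \<in> (\<lambda>f. sum f (I - {i})) ` Pi\<^sub>E (I - {i}) X"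
    using tiles_member_rest[OF assms(1,2,4) _ assms(6)] by simp
  then have "x = 0"
    by (rule complementary_disjoint[OF tiles_complementary[OF assms(1-3)] assms(5)])
  then show False
    using assms(7) by simp
qed

text \<open>A sum of naturals equal to 1 has a term equal to 1. The index found, unique by
  \<open>tiles_disjoint\<close>, is called the owner of the unit below.\<close>

lemma tiles_owner:
  assumes "tiles I X" "finite I"
  obtains i where "i \<in> I" "1 \<in> X i"
proof -
  obtain f where f: "f \<in> Pi\<^sub>E I X" "sum f I = 1"
    by (rule tilesE[OF assms(1)])
  then obtain i where "i \<in> I" "f i = 1"
    using assms(2) by (metis One_nat_def sum_eq_1_iff)
  then show ?thesis
    using that f(1) by (metis PiE_mem)
qed

text \<open>Here \<open>g\<close> is the least positive element of the sumset of the other summands.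
  Any positive term of a family with sum \<open>g\<close> lies in that sumset, so it is at least
  \<open>g\<close>; hence \<open>g\<close> itself belongs to a single \<open>X j\<close>.\<close>

lemma tiles_blocks:
  assumes t: "tiles I X" and I: "finite I" "i \<in> I" and one: "1 \<in> X i" and ne: "X i \<noteq> UNIV"
  obtains g j where "g > 1" "j \<in> I - {i}" "g \<in> X j" "{..<g} \<subseteq> X i" "g \<notin> X i"
    "\<forall>j\<in>I - {i}. \<forall>x\<in>X j. g dvd x" "\<forall>x. x \<in> X i \<longleftrightarrow> g * (x div g) \<in> X i"
proof -
  let ?Y = "(\<lambda>f. sum f (I - {i})) ` Pi\<^sub>E (I - {i}) X"
  note c = tiles_complementary[OF t I]
  obtain n where "n \<notin> X i"
    using ne by blast
  moreover obtain x y where "x \<in> X i" "y \<in> ?Y" "n = x + y"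
    by (rule complementaryE[OF c])
  ultimately have ex: "\<exists>y. y \<in> ?Y \<and> 0 < y"
    by (metis add_0_right neq0_conv)
  define g where "g = (LEAST y. y \<in> ?Y \<and> 0 < y)"
  have g: "g \<in> ?Y" "0 < g"
    unfolding g_def using LeastI_ex[OF ex] by blast+
  have min: "g \<le> y" if "y \<in> ?Y" "0 < y" for y
    unfolding g_def using that by (simp add: Least_le)
  have blocks: "y \<in> ?Y \<Longrightarrow> g dvd y" "x \<in> X i \<longleftrightarrow> g * (x div g) \<in> X i" for x y
    using complementary_blocks[OF c g] min by blast+
  have gX: "g \<notin> X i"
    using complementary_disjoint[OF c _ g(1)] g(2) by auto
  have low: "{..<g} \<subseteq> X i"
  proof
    fix x
    assume "x \<in> {..<g}"
    then show "x \<in> X i"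
      using blocks(2)[of x] complementary_zero(1)[OF c] by (metis div_less lessThan_iff mult_0_right)
  qed
  have "g > 1"
    using one gX g(2) by (metis less_one nat_neq_iff)
  obtain j where "j \<in> I - {i}" "g \<in> X j"
  proof -
    obtain f where f: "f \<in> Pi\<^sub>E (I - {i}) X" "g = sum f (I - {i})"
      using g(1) by blast
    obtain j where j: "j \<in> I - {i}" "f j > 0"
      using f(2) g(2) by (metis neq0_conv sum.neutral)
    then have fj: "f j \<in> X j"
      using f(1) by (metis PiE_mem)
    have "f j \<le> g"
      using f(2) j(1) I(1) by (simp add: member_le_sum)
    moreover have "g \<le> f j"
      using min[OF tiles_member_rest[OF t I(1) _ _ fj]] j by blast
    ultimately show ?thesis
      using that j(1) fj by (metis le_antisym)
  qed
  have "\<forall>j\<in>I - {i}. \<forall>x\<in>X j. g dvd x"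
  proof (intro ballI)
    fix j x
    assume j: "j \<in> I - {i}" and x: "x \<in> X j"
    have "j \<in> I" "j \<noteq> i"
      using j by auto
    then show "g dvd x"
      by (rule blocks(1)[OF tiles_member_rest[OF t I(1) _ _ x]])
  qed
  moreover have "\<forall>x. x \<in> X i \<longleftrightarrow> g * (x div g) \<in> X i"
    by (intro allI blocks(2))
  ultimately show ?thesis
    by (rule that[OF \<open>g > 1\<close> \<open>j \<in> I - {i}\<close> \<open>g \<in> X j\<close> low gX])
qed

text \<open>In a family with sum \<open>d * n\<close> all terms but the \<open>i\<close>-th are
  multiples of \<open>d\<close>, hence so is the \<open>i\<close>-th, and the family can be divided
  by \<open>d\<close>.\<close>

lemma tiles_quotient:
  assumes t: "tiles I X" and I: "finite I" "i \<in> I" and d: "d > 0"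
    and dvd: "\<And>j x. j \<in> I - {i} \<Longrightarrow> x \<in> X j \<Longrightarrow> d dvd x"
  shows "tiles I (\<lambda>j. {x. d * x \<in> X j})"
  unfolding tiles_def
proof
  fix n
  obtain f where f: "f \<in> Pi\<^sub>E I X" "sum f I = d * n"
    by (rule tilesE[OF t])
  have "d dvd f j" if "j \<in> I - {i}" for j
    using dvd[OF that] f(1) that by (metis DiffD1 PiE_mem)
  moreover from this have "d dvd f i"
    using f(2) sum.remove[OF I, of f] by (metis dvd_add_left_iff dvd_sum dvd_triv_left)
  ultimately have df: "d dvd f j" if "j \<in> I" for j
    using that by blast
  let ?h = "restrict (\<lambda>j. f j div d) I"
  show "\<exists>!f. f \<in> (\<Pi>\<^sub>E j\<in>I. {x. d * x \<in> X j}) \<and> sum f I = n"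
  proof (intro ex1I conjI)
    show "?h \<in> (\<Pi>\<^sub>E j\<in>I. {x. d * x \<in> X j})"
      using f(1) df by (auto simp: PiE_mem)
    have "d * sum ?h I = sum f I"
      unfolding sum_distrib_left using df by (intro sum.cong) auto
    then show "sum ?h I = n"
      using f(2) d by simp
  next
    fix h
    assume h: "h \<in> (\<Pi>\<^sub>E j\<in>I. {x. d * x \<in> X j}) \<and> sum h I = n"
    have "restrict (\<lambda>j. d * h j) I \<in> Pi\<^sub>E I X"
      using h by auto
    moreover have "sum (restrict (\<lambda>j. d * h j) I) I = d * n"
      using h by (auto simp: sum_distrib_left intro: sum.cong)
    ultimately have "restrict (\<lambda>j. d * h j) I = f"
      using tiles_unique[OF t] f by metis
    then have *: "f j = d * h j" if "j \<in> I" for j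
      using that by auto
    show "h = ?h"
    proof
      fix j
      show "h j = ?h j"
        using * d h by (cases "j \<in> I") (auto simp: PiE_def extensional_def)
    qed
  qed
qed

section \<open>Digit sets and powers of the base\<close>

text \<open>Written through digit extraction instead of sums, so that the lowest digit can be split
  off; \<open>A_set_eq_digit_set\<close> brings \<open>A_set\<close> into this form.\<close>

definition digit_set :: "nat \<Rightarrow> nat set \<Rightarrow> nat set" where
  "digit_set b P = {x. \<forall>t. x div b ^ t mod b \<noteq> 0 \<longrightarrow> t \<in> P}"

lemma digit_set_rec:
  "x \<in> digit_set b P \<longleftrightarrow> (x mod b \<noteq> 0 \<longrightarrow> 0 \<in> P) \<and> x div b \<in> digit_set b {t. Suc t \<in> P}"
proof -
  have "(\<forall>t. x div b ^ t mod b \<noteq> 0 \<longrightarrow> t \<in> P) \<longleftrightarrow>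
    (x mod b \<noteq> 0 \<longrightarrow> 0 \<in> P) \<and> (\<forall>t. x div b ^ Suc t mod b \<noteq> 0 \<longrightarrow> Suc t \<in> P)"
    by (metis div_by_1 not0_implies_Suc power_0)
  then show ?thesis
    by (simp add: digit_set_def div_mult2_eq)
qed

lemma zero_in_digit_set: "0 \<in> digit_set b P"
  by (simp add: digit_set_def)

section \<open>Unique representability forces powers of one base\<close>

locale unit_representation =
  fixes L A :: "nat set"
  assumes finite_L: "finite L"
    and pos_L: "l \<in> L \<Longrightarrow> l > 0"
    and tiles_L: "tiles L (\<lambda>l. (*) l ` A)"
    and proper: "A \<noteq> UNIV"
begin

lemma one_mem: "1 \<in> L" "1 \<in> A"
proof -
  obtain l where "l \<in> L" "1 \<in> (*) l ` A"
    by (rule tiles_owner[OF tiles_L finite_L])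
  then show "1 \<in> L" "1 \<in> A"
    by auto
qed

lemma self_mem: "l \<in> (*) l ` A"
  using one_mem(2) by force

lemma zero_mem: "0 \<in> A"
  using tiles_zero[OF tiles_L finite_L one_mem(1)] by auto

text \<open>The base is the block length \<open>g\<close> of \<open>A\<close>. If \<open>g\<close>
  lies in the dilate of \<open>A\<close> by \<open>j\<close>, then \<open>j dvd g\<close>; and
  \<open>j = j * 1\<close> lies there too, so \<open>g dvd j\<close>. Thus \<open>g = j\<close> is a
  coefficient.\<close>

lemma base_exists:
  obtains b where "b > 1" "b \<in> L" "{..<b} \<subseteq> A"
    "\<forall>l\<in>L - {1}. \<forall>x\<in>(*) l ` A. b dvd x" "\<forall>x. x \<in> A \<longleftrightarrow> b * (x div b) \<in> A"
proof -
  have A1: "(*) 1 ` A = A"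
    by auto
  obtain g j where g: "g > 1" "j \<in> L - {1}" "g \<in> (*) j ` A" "{..<g} \<subseteq> A"
    and dvd: "\<forall>l\<in>L - {1}. \<forall>x\<in>(*) l ` A. g dvd x"
    and blocks: "\<forall>x. x \<in> A \<longleftrightarrow> g * (x div g) \<in> A"
    by (rule tiles_blocks[OF tiles_L finite_L one_mem(1)]; unfold A1) (use one_mem(2) proper in blast)+
  have "g dvd j"
    using dvd g(2) self_mem by blast
  moreover have "j dvd g"
    using g(3) by auto
  ultimately have "g \<in> L"
    using g(2) by (metis DiffD1 dvd_antisym)
  then show ?thesis
    by (rule that[OF g(1) _ g(4) dvd blocks])
qed

end

locale unit_representation_base = unit_representation +
  fixes b :: nat
  assumes b_gt: "b > 1" and b_mem: "b \<in> L" and low: "{..<b} \<subseteq> A"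
    and dvd_rest: "\<forall>l\<in>L - {1}. \<forall>x\<in>(*) l ` A. b dvd x"
    and blocks: "\<forall>x. x \<in> A \<longleftrightarrow> b * (x div b) \<in> A"
begin

text \<open>The summands after \<open>t\<close> divisions by the base, in closed form. By
  \<open>quot_power\<close> the dilate by \<open>b ^ s\<close> repeats \<open>A\<close> at level
  \<open>t - s\<close>, which makes earlier levels usable.\<close>

definition quot :: "nat \<Rightarrow> nat \<Rightarrow> nat set" where
  "quot t l = {x. b ^ t * x \<in> (*) l ` A}"

lemma quot_0: "quot 0 = (\<lambda>l. (*) l ` A)"
  unfolding quot_def power_0 mult_1 Collect_mem_eq ..

lemma quot_Suc: "quot (Suc t) l = {x. b * x \<in> quot t l}"
  by (simp add: quot_def ac_simps)

lemma quot_1: "x \<in> quot t 1 \<longleftrightarrow> b ^ t * x \<in> A"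
  by (simp add: quot_def)

lemma quot_power:
  assumes "s \<le> t"
  shows "quot t (b ^ s) = quot (t - s) 1"
proof -
  have "b ^ t = b ^ s * b ^ (t - s)"
    using assms by (simp flip: power_add)
  then show ?thesis
    using b_gt by (auto simp: quot_def mult.assoc)
qed

text \<open>The invariant of the induction over levels, stated for the owner of the unit. Its
  divisibility half permits the next division by \<open>b\<close>; its block half makes the lowest
  digit of the owner free.\<close>

definition aligned :: "nat \<Rightarrow> bool" where
  "aligned t \<longleftrightarrow> (\<forall>i\<in>L. 1 \<in> quot t i \<longrightarrow>
     (\<forall>j\<in>L - {i}. \<forall>x\<in>quot t j. b dvd x) \<and> (\<forall>x. x \<in> quot t i \<longleftrightarrow> b * (x div b) \<in> quot t i))"

lemma tiles_quot:
  assumes "\<And>s. s < t \<Longrightarrow> aligned s"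
  shows "tiles L (quot t)"
  using assms
proof (induction t)
  case 0
  then show ?case
    using tiles_L by (simp add: quot_0)
next
  case (Suc t)
  then have t: "tiles L (quot t)"
    by simp
  obtain i where i: "i \<in> L" "1 \<in> quot t i"
    by (rule tiles_owner[OF t finite_L])
  have "b dvd x" if "j \<in> L - {i}" "x \<in> quot t j" for j x
    using Suc.prems[of t] i that unfolding aligned_def by blast
  from tiles_quotient[OF t finite_L i(1) _ this] show ?case
    using b_gt by (simp add: quot_Suc)
qed

text \<open>Otherwise \<open>b ^ (t + 1)\<close> lies in the dilates of \<open>A\<close> by 1 and by
  \<open>b\<close>.\<close>

lemma next_power_notin:
  assumes "tiles L (quot t)" "b ^ t \<in> A"
  shows "b \<notin> quot t 1"
proof
  assume 1: "b \<in> quot t 1"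
  have "b ^ t * b \<in> (*) b ` A"
    using assms(2) by (metis imageI mult.commute)
  then have "b \<in> quot t b"
    by (simp add: quot_def)
  then have "1 = b"
    using tiles_disjoint[OF assms(1) finite_L one_mem(1) b_mem 1] b_gt by simp
  then show False
    using b_gt by simp
qed

text \<open>The coefficient \<open>b ^ t * x\<close> lies in its own dilate, so its summand at level
  \<open>t\<close> contains the non-multiple \<open>x\<close> of \<open>b\<close>. By alignment it
  owns the unit, so it divides \<open>b ^ t\<close>.\<close>

lemma aligned_member_power:
  assumes t: "tiles L (quot t)" "aligned t" and l: "b ^ t * x \<in> L" "\<not> b dvd x"
  shows "x = 1"
proof -
  let ?l = "b ^ t * x"
  obtain i where i: "i \<in> L" "1 \<in> quot t i"
    by (rule tiles_owner[OF t(1) finite_L])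
  have "x \<in> quot t ?l"
    using self_mem[of ?l] unfolding quot_def by blast
  then have "i = ?l"
    using t(2) i l unfolding aligned_def by blast
  then have "?l dvd b ^ t"
    using i(2) by (auto simp: quot_def intro: dvdI)
  then show ?thesis
    using b_gt by (simp add: nat_mult_dvd_cancel_disj)
qed

text \<open>A non-multiple of \<open>b\<close> in \<open>A\<close> at level \<open>t\<close> reveals
  that the index 1 owns the unit, so the block half of the invariant applies to
  \<open>A\<close>.\<close>

lemma aligned_block:
  assumes t: "tiles L (quot t)" "aligned t" and x: "x \<in> quot t 1" "\<not> b dvd x"
  shows "y \<in> quot t 1 \<longleftrightarrow> b * (y div b) \<in> quot t 1" "y < b \<Longrightarrow> b ^ t * y \<in> A"
proof -
  obtain i where i: "i \<in> L" "1 \<in> quot t i"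
    by (rule tiles_owner[OF t(1) finite_L])
  have "i = 1"
    using t(2) i x one_mem(1) unfolding aligned_def by blast
  then show block: "y \<in> quot t 1 \<longleftrightarrow> b * (y div b) \<in> quot t 1"
    using t(2) i unfolding aligned_def by blast
  show "b ^ t * y \<in> A" if "y < b"
    using block that zero_mem unfolding quot_1 by simp
qed

lemma power_factor:
  assumes "n > 0"
  obtains s y where "n = b ^ s * y" "\<not> b dvd y"
  using assms
proof (induction n arbitrary: thesis rule: less_induct)
  case (less n)
  show ?case
  proof (cases "b dvd n")
    case True
    then obtain m where m: "n = b * m"
      by blast
    then have "m < n" "m > 0"
      using less.prems(2) b_gt by auto
    then show ?thesis
      using less.IH[of m] less.prems(1)[of "Suc s" for s] m by (metis mult.assoc power_Suc)
  next
    case False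
    then show ?thesis
      using less.prems(1)[of 0 n] by simp
  qed
qed

text \<open>The owner divides \<open>b ^ t\<close>. After taking out the full power
  \<open>b ^ s\<close>, the cofactor is 1: for \<open>s = t\<close> by this divisibility, for
  \<open>s < t\<close> by \<open>aligned_member_power\<close> at level \<open>s\<close>.\<close>

lemma owner_power:
  assumes IH: "\<And>s. s < t \<Longrightarrow> aligned s" and i: "i \<in> L" "1 \<in> quot t i"
  obtains s where "s \<le> t" "i = b ^ s"
proof -
  obtain s y where sy: "i = b ^ s * y" "\<not> b dvd y"
    using power_factor pos_L[OF i(1)] by metis
  have dvd: "i dvd b ^ t"
    using i(2) by (auto simp: quot_def intro: dvdI)
  then have "b ^ s dvd b ^ t"
    using sy(1) dvd_mult_left by blast
  then have "s \<le> t"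
    using b_gt by (simp add: dvd_power_iff_le)
  have "y = 1"
  proof (cases "s = t")
    case True
    then show ?thesis
      using dvd sy b_gt by (simp add: nat_mult_dvd_cancel_disj)
  next
    case False
    then have "s < t"
      using \<open>s \<le> t\<close> by simp
    then show ?thesis
      using aligned_member_power[OF tiles_quot IH[of s]] IH i(1) sy by simp
  qed
  then show ?thesis
    using that[of s] \<open>s \<le> t\<close> sy(1) by simp
qed

text \<open>\<open>X = quot t i\<close> has the block structure of some width \<open>g\<close>; all that is missing is
  \<open>b dvd g\<close>. If \<open>i\<close> is a proper power of \<open>b\<close>, then \<open>X\<close> already occurred at an earlier level.\<close>

lemma aligned: "aligned t"
proof (induction t rule: less_induct)
  case (less t)
  have tiles_le: "tiles L (quot s)" if "s \<le> t" for s
    using tiles_quot less that by simp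
  show ?case
  proof (cases "t = 0")
    case True
    have "i = 1" if "1 \<in> quot 0 i" for i
      using that by (auto simp: quot_0)
    moreover have "(*) 1 ` A = A"
      by auto
    ultimately show ?thesis
      using dvd_rest blocks unfolding aligned_def True quot_0 by (metis (no_types, lifting))
  next
    case False
    show ?thesis
      unfolding aligned_def
    proof (intro ballI impI)
      fix i
      assume i: "i \<in> L" "1 \<in> quot t i"
      obtain s where s: "s \<le> t" "i = b ^ s"
        by (rule owner_power[OF less i])
      define r where "r = t - s"
      have qr: "quot t i = quot r 1"
        using quot_power[OF s(1)] s(2) by (simp add: r_def)
      have br: "b ^ r \<in> A"
        using i(2) unfolding qr quot_1 by simp
      \<comment> \<open>This excludes that the owner is all of the naturals, as
        \<open>tiles_blocks\<close> demands.\<close>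
      have "b \<notin> quot t i"
        unfolding qr using next_power_notin[OF tiles_le br] by (simp add: r_def)
      then have ne: "quot t i \<noteq> UNIV"
        by blast
      obtain g j where g: "g > 1" "j \<in> L - {i}" "g \<in> quot t j" "{..<g} \<subseteq> quot t i" "g \<notin> quot t i"
        and dvd: "\<forall>j\<in>L - {i}. \<forall>x\<in>quot t j. g dvd x"
        and blocks: "\<forall>x. x \<in> quot t i \<longleftrightarrow> g * (x div g) \<in> quot t i"
        by (rule tiles_blocks[OF tiles_le[OF order_refl] finite_L i ne])
      have "b dvd g"
      proof (cases "s = 0")
        case False
        then have r: "r < t"
          using s(1) by (simp add: r_def)
        have one: "1 \<in> quot r 1"
          using br unfolding quot_1 by simp
        have "\<not> b dvd 1"
          using b_gt by simp
        note block = aligned_block(1)[OF tiles_le[OF less_imp_le[OF r]] less[OF r] one this, of g]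
        \<comment> \<open>At level \<open>r < t\<close> this summand is known to be a union of
          blocks of length \<open>b\<close>. If \<open>b\<close> did not divide \<open>g\<close>,
          the block containing \<open>g\<close> would start below \<open>g\<close>, hence inside the
          summand, and so would contain \<open>g\<close>.\<close>
        show ?thesis
        proof (rule ccontr)
          assume "\<not> b dvd g"
          then have "b * (g div b) < g"
            by (metis dvd_triv_left le_neq_implies_less times_div_less_eq_dividend)
          then have "b * (g div b) \<in> quot r 1"
            using g(4) unfolding qr by blast
          then show False
            using block g(5) unfolding qr by blast
        qed
      next
        case True
        then have i1: "i = 1" and r: "r = t"
          using s by (simp_all add: r_def)
        have bq: "b \<in> quot t b"
        proof -
          have "b ^ t * b \<in> (*) b ` A"
            using br unfolding r by (metis imageI mult.commute)
          then show ?thesis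
            by (simp add: quot_def)
        qed
        then have gb: "g dvd b"
          using dvd b_mem i1 b_gt by auto
        obtain s' y where sy: "j = b ^ s' * y" "\<not> b dvd y"
          using power_factor pos_L g(2) by (metis DiffD1)
        obtain a where a: "a \<in> A" "b ^ t * g = j * a"
          using g(3) by (auto simp: quot_def)
        show ?thesis
        proof (rule ccontr)
          assume ng: "\<not> b dvd g"
          show False
          proof (cases "s' < t")
            \<comment> \<open>Now \<open>quot t j\<close> repeats \<open>A\<close> at level
              \<open>t - s' < t\<close> and contains \<open>g\<close>, no multiple of
              \<open>b\<close>. So it contains the full first block, and 1 would have two
              owners.\<close>
            case True
            have j: "j = b ^ s'"
              using aligned_member_power[OF tiles_le less[OF True]] True sy g(2) by simp
            have q: "quot t j = quot (t - s') 1"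
              using quot_power[of s' t] True j by simp
            have "s' > 0"
              using g(2) i1 j by (cases s') auto
            then have lt: "t - s' < t"
              using True by simp
            have "b ^ (t - s') * 1 \<in> A"
              by (rule aligned_block(2)[OF tiles_le[OF less_imp_le[OF lt]] less[OF lt] g(3)[unfolded q] ng b_gt])
            then have "1 \<in> quot t j"
              unfolding q quot_1 by simp
            then show False
              using tiles_disjoint[OF tiles_le[OF order_refl] finite_L i(1) _ i(2)] g(2) by auto
          next
            \<comment> \<open>Now \<open>j = b ^ t * z\<close>, where \<open>z\<close> and
              \<open>g\<close> divide each other, so \<open>j = b ^ t * g\<close>. Since
              \<open>b = g * c\<close> with \<open>c < b\<close> in \<open>A\<close>, the number
              \<open>b ^ t * b = j * c\<close> lies in the dilates by \<open>j\<close> and by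
              \<open>b\<close>. This forces \<open>j = b\<close>, but \<open>j\<close> is
              larger.\<close>
            case False
            define z where "z = b ^ (s' - t) * y"
            have "b ^ s' = b ^ t * b ^ (s' - t)"
              using False by (simp flip: power_add)
            then have j: "j = b ^ t * z"
              unfolding z_def sy(1) by (simp only: mult.assoc)
            have "z \<in> quot t j"
              using self_mem[of j] unfolding quot_def j by blast
            then have "g dvd z"
              using dvd g(2) by blast
            moreover have "z dvd g"
            proof -
              have "b ^ t * g = b ^ t * (z * a)"
                using a(2) unfolding j by (simp only: mult.assoc)
              then have "g = z * a"
                using b_gt by simp
              then show ?thesis
                by (rule dvdI)
            qed
            ultimately have "z = g"
              using dvd_antisym by blast
            with j have jg: "j = b ^ t * g"
              by simp
            obtain c where c: "b = g * c"
              using gb by blast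
            have "c < b"
              using c g(1) b_gt by (cases "c = 0") auto
            then have "c \<in> A"
              using low by blast
            then have "b ^ t * b \<in> (*) j ` A"
              unfolding c jg by (metis imageI mult.assoc)
            then have "b \<in> quot t j"
              by (simp add: quot_def)
            then have "j = b"
              using tiles_disjoint[OF tiles_le[OF order_refl] finite_L _ b_mem _ bq] g(2) b_gt by simp
            moreover have "b \<le> b ^ t"
              using \<open>t \<noteq> 0\<close> b_gt by (simp add: self_le_power)
            then have "b < b ^ t * g"
              using g(1) b_gt by (metis gr_implies_not0 le_less_trans mult.right_neutral mult_less_cancel1 not_gr0 power_not_zero)
            ultimately show False
              using jg by simp
          qed
        qed
      qed
      then obtain c where c: "g = b * c"
        by blast
      show "(\<forall>j\<in>L - {i}. \<forall>x\<in>quot t j. b dvd x) \<and> (\<forall>x. (x \<in> quot t i) = (b * (x div b) \<in> quot t i))"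
      proof (intro conjI ballI allI)
        show "b dvd x" if "j \<in> L - {i}" "x \<in> quot t j" for j x
          using dvd that \<open>b dvd g\<close> dvd_trans by blast
        \<comment> \<open>As \<open>b\<close> divides \<open>g\<close>, rounding down to a multiple
          of \<open>b\<close> stays within the same block of length \<open>g\<close>.\<close>
        show "(x \<in> quot t i) = (b * (x div b) \<in> quot t i)" for x
        proof -
          have "b * (x div b) div g = x div g"
            using b_gt unfolding c by (simp add: div_mult2_eq)
          then show ?thesis
            using blocks by metis
        qed
      qed
    qed
  qed
qed

lemma tiles_quot_all: "tiles L (quot t)"
  by (simp add: tiles_quot aligned)

lemma member_power:
  assumes "l \<in> L"
  obtains s where "l = b ^ s"
proof -
  obtain s y where "l = b ^ s * y" "\<not> b dvd y"
    using power_factor pos_L[OF assms] by metis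
  then show ?thesis
    using that[of s] aligned_member_power[OF tiles_quot_all aligned, of s y] assms by simp
qed

text \<open>Splitting off the lowest digit of \<open>x\<close> raises the level by one. If the index
  1 owns the unit, that digit is free and \<open>b ^ t\<close> is in \<open>A\<close>; otherwise
  \<open>A\<close> has only multiples of \<open>b\<close> at this level and the digit is 0.\<close>

lemma quot_1_digit_set: "x \<in> quot t 1 \<longleftrightarrow> x \<in> digit_set b {p. b ^ (t + p) \<in> A}"
proof (induction x arbitrary: t rule: less_induct)
  case (less x)
  show ?case
  proof (cases "x = 0")
    case True
    then show ?thesis
      using zero_mem zero_in_digit_set unfolding quot_1 by simp
  next
    case False
    then have "x div b < x"
      using b_gt by simp
    note IH = less[OF this, of "Suc t"]
    obtain i where i: "i \<in> L" "1 \<in> quot t i"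
      by (rule tiles_owner[OF tiles_quot_all finite_L])
    have "x \<in> quot t 1 \<longleftrightarrow> (x mod b \<noteq> 0 \<longrightarrow> b ^ t \<in> A) \<and> b * (x div b) \<in> quot t 1"
    proof (cases "i = 1")
      case True
      then have "\<forall>x. x \<in> quot t 1 \<longleftrightarrow> b * (x div b) \<in> quot t 1"
        using aligned[of t] i unfolding aligned_def by blast
      moreover have "b ^ t \<in> A"
        using i(2) unfolding True quot_1 by simp
      ultimately show ?thesis
        by blast
    next
      case False
      then have "x \<in> quot t 1 \<Longrightarrow> b dvd x"
        using aligned[of t] i one_mem unfolding aligned_def by blast
      moreover have "b ^ t \<notin> A"
        using tiles_disjoint[OF tiles_quot_all finite_L i(1) one_mem(1) i(2)] False quot_1[of 1 t] by auto
      ultimately show ?thesis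
        by (metis dvd_eq_mod_eq_0 dvd_mult_div_cancel)
    qed
    also have "\<dots> \<longleftrightarrow> x \<in> digit_set b {p. b ^ (t + p) \<in> A}"
      using IH unfolding digit_set_rec[of x] quot_Suc by simp
    finally show ?thesis .
  qed
qed

lemma A_eq_digit_set: "A = digit_set b {t. b ^ t \<in> A}"
proof (rule set_eqI)
  show "x \<in> A \<longleftrightarrow> x \<in> digit_set b {t. b ^ t \<in> A}" for x
    using quot_1_digit_set[of x 0] unfolding quot_1 power_0 mult_1 add_0 .
qed

text \<open>The owner at level \<open>n\<close> is some \<open>b ^ s\<close>, and
  \<open>b ^ n = b ^ s * b ^ (n - s)\<close> splits \<open>n\<close>. Splittings with distinct
  \<open>s\<close> would put \<open>b ^ n\<close> into two dilates.\<close>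

lemma exponents_complementary: "complementary {s. b ^ s \<in> L} {t. b ^ t \<in> A}"
  unfolding complementary_def
proof (intro conjI allI ballI impI)
  fix n
  obtain i where i: "i \<in> L" "1 \<in> quot n i"
    by (rule tiles_owner[OF tiles_quot_all finite_L])
  obtain s where s: "s \<le> n" "i = b ^ s"
    by (rule owner_power[OF aligned i])
  have "b ^ (n - s) \<in> A"
    using i(2) unfolding s(2) quot_power[OF s(1)] quot_1 by simp
  moreover have "n = s + (n - s)"
    using s(1) by simp
  ultimately show "\<exists>s\<in>{s. b ^ s \<in> L}. \<exists>t\<in>{t. b ^ t \<in> A}. n = s + t"
    using i(1) s(2) by blast
next
  fix s s' t t'
  assume h: "s \<in> {s. b ^ s \<in> L}" "s' \<in> {s. b ^ s \<in> L}" "t \<in> {t. b ^ t \<in> A}" "t' \<in> {t. b ^ t \<in> A}"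
    "s + t = s' + t'"
  have "b ^ (s + t) \<in> (*) (b ^ s) ` A" "b ^ (s + t) \<in> (*) (b ^ s') ` A"
    using h by (metis (mono_tags) imageI mem_Collect_eq power_add)+
  then have "b ^ s = b ^ s'"
    using tiles_disjoint[OF tiles_L finite_L, of "b ^ s" "b ^ s'" "b ^ (s + t)"] h b_gt by simp
  then show "s = s'"
    using b_gt by simp
qed

end

section \<open>Base expansions and decompositions into digit sets\<close>

lemma digit_set_mono: "x \<in> digit_set b P \<Longrightarrow> P \<subseteq> Q \<Longrightarrow> x \<in> digit_set b Q"
  unfolding digit_set_def by blast

lemma digit_expansion_mod:
  fixes x b :: nat
  shows "x mod b ^ n = (\<Sum>t<n. x div b ^ t mod b * b ^ t)"
proof (induction n)
  case (Suc n)
  have "x mod b ^ Suc n = b ^ n * (x div b ^ n mod b) + x mod b ^ n"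
    using mod_mult2_eq[of x "b ^ n" b] by (simp add: mult.commute)
  then show ?case
    using Suc by (simp add: mult.commute)
qed simp

lemma digit_sum_mem:
  assumes "\<And>t. e t < b"
  shows "(\<Sum>t<n. e t * b ^ t) \<in> digit_set b {t. e t \<noteq> 0}"
  using assms
proof (induction n arbitrary: e)
  case 0
  then show ?case
    by (simp add: zero_in_digit_set)
next
  case (Suc n)
  let ?y = "\<Sum>t<n. e (Suc t) * b ^ t"
  have "(\<Sum>t<Suc n. e t * b ^ t) = e 0 + b * ?y"
    unfolding sum.lessThan_Suc_shift by (simp add: sum_distrib_left ac_simps)
  moreover have "(e 0 + b * ?y) mod b = e 0" "(e 0 + b * ?y) div b = ?y"
    using Suc.prems[of 0] by simp_all
  moreover have "?y \<in> digit_set b {t. e (Suc t) \<noteq> 0}"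
    using Suc.IH[of "\<lambda>t. e (Suc t)"] Suc.prems by simp
  ultimately show ?case
    unfolding digit_set_rec[of "\<Sum>t<Suc n. e t * b ^ t"] by simp
qed

lemma A_set_eq_digit_set:
  assumes "b > 1"
  shows "A_set b k u v = digit_set b (T_set k u v)"
proof (intro equalityI subsetI)
  fix x
  assume "x \<in> A_set b k u v"
  then obtain d where d: "\<forall>t\<in>T_set k u v. d t < b" "finite {t \<in> T_set k u v. d t \<noteq> 0}"
    and x: "x = (\<Sum>t\<in>{t \<in> T_set k u v. d t \<noteq> 0}. d t * b ^ t)"
    unfolding A_set_def by blast
  let ?F = "{t \<in> T_set k u v. d t \<noteq> 0}"
  obtain n where n: "?F \<subseteq> {..<n}"
    using d(2) unfolding finite_nat_set_iff_bounded by blast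
  \<comment> \<open>\<open>d\<close> is arbitrary outside \<open>T_set k u v\<close>; cutting it off
    there gives digits bounded by \<open>b\<close> everywhere.\<close>
  define e where "e t = (if t \<in> ?F then d t else 0)" for t
  have "x = (\<Sum>t\<in>?F. e t * b ^ t)"
    unfolding x by (rule sum.cong) (simp_all add: e_def)
  also have "\<dots> = (\<Sum>t<n. e t * b ^ t)"
    by (rule sum.mono_neutral_left) (use n in \<open>auto simp: e_def\<close>)
  finally have "x \<in> digit_set b {t. e t \<noteq> 0}"
    using digit_sum_mem[of e b n] d(1) assms by (simp add: e_def)
  then show "x \<in> digit_set b (T_set k u v)"
    by (rule digit_set_mono) (auto simp: e_def)
next
  fix x
  assume x: "x \<in> digit_set b (T_set k u v)"
  define d where "d t = x div b ^ t mod b" for t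
  \<comment> \<open>A crude bound: \<open>x\<close> itself serves as the number of digits.\<close>
  have lt: "x < b ^ x"
    using assms by (simp add: power_gt_expt)
  have d0: "d t = 0" if "t \<ge> x" for t
  proof -
    have "x < b ^ t"
      using lt assms that by (meson le_less_trans less_imp_le not_less power_increasing)
    then show ?thesis
      by (simp add: d_def)
  qed
  have dT: "t \<in> T_set k u v" if "d t \<noteq> 0" for t
    using x that unfolding digit_set_def d_def by blast
  have sub: "{t \<in> T_set k u v. d t \<noteq> 0} \<subseteq> {..<x}"
    using d0 not_less by blast
  have "x = (\<Sum>t<x. d t * b ^ t)"
    using digit_expansion_mod[of x b x] lt by (simp add: d_def)
  also have "\<dots> = (\<Sum>t\<in>{t \<in> T_set k u v. d t \<noteq> 0}. d t * b ^ t)"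
    by (rule sum.mono_neutral_right) (use sub dT in auto)
  finally have "x = (\<Sum>t\<in>{t \<in> T_set k u v. d t \<noteq> 0}. d t * b ^ t)" .
  moreover have "\<forall>t\<in>T_set k u v. d t < b"
    using assms by (simp add: d_def)
  moreover have "finite {t \<in> T_set k u v. d t \<noteq> 0}"
    using sub finite_subset by blast
  ultimately show "x \<in> A_set b k u v"
    unfolding A_set_def by blast
qed

text \<open>Each digit position belongs to exactly one index, so the digits of \<open>n\<close> are
  handed out without carries. The induction removes the lowest digit, which goes to the index
  \<open>k\<close> with 0 in \<open>P k\<close>.\<close>

lemma tiles_digit_sets_aux:
  assumes I: "finite I" and b: "b > 1" and P: "\<And>t. \<exists>!i. i \<in> I \<and> t \<in> P i"
  shows "\<exists>!f. f \<in> (\<Pi>\<^sub>E i\<in>I. digit_set b (P i)) \<and> sum f I = n"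
  using P
proof (induction n arbitrary: P rule: less_induct)
  case (less n)
  show ?case
  proof (cases "n = 0")
    case True
    show ?thesis
    proof (intro ex1I conjI)
      show "(\<lambda>i\<in>I. 0) \<in> (\<Pi>\<^sub>E i\<in>I. digit_set b (P i))"
        by (auto simp: zero_in_digit_set)
      show "sum (\<lambda>i\<in>I. 0) I = n"
        using True by simp
    next
      fix f
      assume f: "f \<in> (\<Pi>\<^sub>E i\<in>I. digit_set b (P i)) \<and> sum f I = n"
      show "f = (\<lambda>i\<in>I. 0)"
        using f True I by (intro ext) (auto simp: PiE_def extensional_def)
    qed
  next
    case False
    define P' where "P' i = {t. Suc t \<in> P i}" for i
    have "n div b < n"
      using False b by simp
    moreover have "\<exists>!i. i \<in> I \<and> t \<in> P' i" for t
      using less.prems[of "Suc t"] by (simp add: P'_def)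
    ultimately have ex1: "\<exists>!f. f \<in> (\<Pi>\<^sub>E i\<in>I. digit_set b (P' i)) \<and> sum f I = n div b"
      by (rule less.IH)
    then obtain f' where f': "f' \<in> (\<Pi>\<^sub>E i\<in>I. digit_set b (P' i))" "sum f' I = n div b"
      by blast
    obtain k where k: "k \<in> I" "0 \<in> P k" and k_unique: "\<And>i. i \<in> I \<Longrightarrow> 0 \<in> P i \<Longrightarrow> i = k"
      using less.prems[of 0] by blast
    define r where "r i = (if i = k then n mod b else 0)" for i
    define f where "f = (\<lambda>i\<in>I. b * f' i + r i)"
    have sum_r: "sum r I = n mod b"
      unfolding r_def using k(1) I by simp
    have rb: "r i < b" for i
      using b by (simp add: r_def)
    show ?thesis
    proof (intro ex1I conjI)
      show "f \<in> (\<Pi>\<^sub>E i\<in>I. digit_set b (P i))"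
      proof
        fix i
        assume i: "i \<in> I"
        have "(b * f' i + r i) mod b = r i" "(b * f' i + r i) div b = f' i"
          using rb[of i] by simp_all
        moreover have "f' i \<in> digit_set b {t. Suc t \<in> P i}"
          using f'(1) i by (auto simp: P'_def)
        moreover have "r i \<noteq> 0 \<longrightarrow> 0 \<in> P i"
          using k(2) by (simp add: r_def)
        ultimately show "f i \<in> digit_set b (P i)"
          using i unfolding f_def digit_set_rec[of _ b "P i"] by simp
      qed (simp add: f_def)
      have "sum f I = (\<Sum>i\<in>I. b * f' i + r i)"
        unfolding f_def by (rule sum.cong) auto
      also have "\<dots> = b * sum f' I + sum r I"
        by (simp add: sum.distrib sum_distrib_left)
      also have "\<dots> = n"
        unfolding f'(2) sum_r by simp
      finally show "sum f I = n" .
    next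
      fix h
      assume h: "h \<in> (\<Pi>\<^sub>E i\<in>I. digit_set b (P i)) \<and> sum h I = n"
      have hrec: "(h i mod b \<noteq> 0 \<longrightarrow> 0 \<in> P i) \<and> h i div b \<in> digit_set b (P' i)" if "i \<in> I" for i
        using h that digit_set_rec[of "h i" b "P i"] unfolding P'_def by (metis PiE_mem)
      define g where "g = (\<lambda>i\<in>I. h i div b)"
      \<comment> \<open>Only \<open>k\<close> may have a nonzero lowest digit, so the lowest digits
        add up to less than \<open>b\<close>, and division of \<open>n\<close> by \<open>b\<close>
        separates them from the rest.\<close>
      have hk: "h i mod b = (if i = k then h k mod b else 0)" if "i \<in> I" for i
        using hrec[OF that] k_unique[OF that] by auto
      have "sum h I = (\<Sum>i\<in>I. b * g i + (if i = k then h k mod b else 0))"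
        using hk by (intro sum.cong) (simp_all add: g_def flip: hk)
      also have "\<dots> = b * sum g I + h k mod b"
        using k(1) I by (simp add: sum.distrib sum_distrib_left)
      finally have n: "n = b * sum g I + h k mod b"
        using h by simp
      have "sum g I = n div b" and nk: "h k mod b = n mod b"
        unfolding n using b by simp_all
      moreover have "g \<in> (\<Pi>\<^sub>E i\<in>I. digit_set b (P' i))"
        using hrec by (auto simp: g_def)
      ultimately have "g = f'"
        using ex1 f' by blast
      show "h = f"
      proof
        fix i
        show "h i = f i"
        proof (cases "i \<in> I")
          case True
          then have "h i = b * f' i + h i mod b"
            using \<open>g = f'\<close> by (metis g_def mult_div_mod_eq restrict_apply')
          then show ?thesis
            using True hk[OF True] nk by (simp add: f_def r_def)
        next
          case False
          then show ?thesis
            using h by (auto simp: f_def PiE_def extensional_def)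
        qed
      qed
    qed
  qed
qed

lemma tiles_digit_sets:
  assumes "finite I" "b > 1" "\<And>t. \<exists>!i. i \<in> I \<and> t \<in> P i"
  shows "tiles I (\<lambda>i. digit_set b (P i))"
  unfolding tiles_def using tiles_digit_sets_aux[OF assms] by blast

lemma tiles_cong:
  assumes "\<And>i. i \<in> I \<Longrightarrow> X i = Y i"
  shows "tiles I X \<longleftrightarrow> tiles I Y"
  unfolding tiles_def using PiE_cong[of I X Y] assms by simp

lemma mult_base_digit_set:
  assumes "b > 1"
  shows "(*) b ` digit_set b P = digit_set b (Suc ` P)"
proof -
  have "{t. Suc t \<in> Suc ` P} = P" "0 \<notin> Suc ` P"
    by auto
  then have *: "x \<in> digit_set b (Suc ` P) \<longleftrightarrow> b dvd x \<and> x div b \<in> digit_set b P" for x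
    unfolding digit_set_rec[of x b "Suc ` P"] by (simp add: dvd_eq_mod_eq_0)
  show ?thesis
  proof (intro set_eqI iffI)
    fix x
    assume x: "x \<in> digit_set b (Suc ` P)"
    then have "x = b * (x div b)" "x div b \<in> digit_set b P"
      using * by simp_all
    then show "x \<in> (*) b ` digit_set b P"
      by (rule image_eqI)
  next
    fix x
    assume "x \<in> (*) b ` digit_set b P"
    then obtain y where "x = b * y" "y \<in> digit_set b P"
      by blast
    then show "x \<in> digit_set b (Suc ` P)"
      using assms unfolding * by simp
  qed
qed

lemma mult_power_digit_set:
  assumes "b > 1"
  shows "(*) (b ^ s) ` digit_set b P = digit_set b ((+) s ` P)"
proof (induction s)
  case (Suc s)
  have "(*) (b ^ Suc s) ` digit_set b P = (*) b ` (*) (b ^ s) ` digit_set b P"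
    by (simp add: image_image mult.assoc)
  also have "\<dots> = digit_set b (Suc ` (+) s ` P)"
    unfolding Suc by (rule mult_base_digit_set[OF assms])
  also have "Suc ` (+) s ` P = (+) (Suc s) ` P"
    by (simp add: image_image)
  finally show ?case .
qed simp

text \<open>Multiplication by \<open>b ^ s\<close> shifts digit positions by \<open>s\<close>, and
  the translates of \<open>T\<close> by the elements of \<open>S\<close> partition the
  naturals.\<close>

lemma tiles_powers_digit_set:
  assumes c: "complementary S T" and S: "finite S" and b: "b > 1"
  shows "tiles ((^) b ` S) (\<lambda>l. (*) l ` digit_set b T)"
proof -
  define P where "P l = {t. \<exists>s \<tau>. l = b ^ s \<and> \<tau> \<in> T \<and> t = s + \<tau>}" for l
  have P: "P (b ^ s) = (+) s ` T" for s
    using b by (auto simp: P_def)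
  have "\<exists>!l. l \<in> (^) b ` S \<and> t \<in> P l" for t
  proof -
    obtain s \<tau> where s: "s \<in> S" "\<tau> \<in> T" "t = s + \<tau>"
      by (rule complementaryE[OF c])
    show ?thesis
    proof (intro ex1I conjI)
      show "b ^ s \<in> (^) b ` S" "t \<in> P (b ^ s)"
        using s P by auto
    next
      fix l
      assume "l \<in> (^) b ` S \<and> t \<in> P l"
      then obtain s' \<tau>' where "s' \<in> S" "l = b ^ s'" "\<tau>' \<in> T" "t = s' + \<tau>'"
        using P by auto
      then show "l = b ^ s"
        using complementary_unique(1)[OF c s(1) _ s(2)] s(3) by metis
    qed
  qed
  then have tiles: "tiles ((^) b ` S) (\<lambda>l. digit_set b (P l))"
    using S b by (intro tiles_digit_sets) simp_all
  have eq: "digit_set b (P l) = (*) l ` digit_set b T" if l: "l \<in> (^) b ` S" for l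
  proof -
    obtain s where s: "l = b ^ s"
      using l by blast
    show ?thesis
      unfolding s P mult_power_digit_set[OF b] ..
  qed
  show ?thesis
    by (rule iffD1[OF tiles_cong tiles]) (rule eq)
qed

section \<open>From counting solutions to direct sum decompositions\<close>

lemma ex1_bij_betw:
  assumes "bij_betw \<phi> P Q"
  shows "(\<exists>!x. x \<in> P \<and> h (\<phi> x) = n) \<longleftrightarrow> (\<exists>!y. y \<in> Q \<and> h y = n)"
proof -
  have Q: "Q = \<phi> ` P" and inj: "inj_on \<phi> P"
    using assms by (simp_all add: bij_betw_def)
  show ?thesis
  proof
    assume "\<exists>!x. x \<in> P \<and> h (\<phi> x) = n"
    then obtain x where "x \<in> P" "h (\<phi> x) = n" "\<And>x'. x' \<in> P \<Longrightarrow> h (\<phi> x') = n \<Longrightarrow> x' = x"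
      by blast
    then show "\<exists>!y. y \<in> Q \<and> h y = n"
      unfolding Q by (intro ex1I[of _ "\<phi> x"]) blast+
  next
    assume "\<exists>!y. y \<in> Q \<and> h y = n"
    then obtain x where "x \<in> P" "h (\<phi> x) = n" "\<And>x'. x' \<in> P \<Longrightarrow> h (\<phi> x') = n \<Longrightarrow> \<phi> x' = \<phi> x"
      unfolding Q by blast
    then show "\<exists>!x. x \<in> P \<and> h (\<phi> x) = n"
      by (intro ex1I[of _ x]) (blast intro: inj_onD[OF inj])+
  qed
qed

lemma card_eq_1_iff_ex1: "card A = 1 \<longleftrightarrow> (\<exists>!x. x \<in> A)"
  unfolding One_nat_def card_1_singleton_iff by (metis empty_iff insert_iff insertI1 subset_antisym subsetI)

text \<open>Solutions correspond to families of terms \<open>l * a\<close> indexed by coefficient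
  values: injectivity of \<open>lam\<close> allows the reindexing, positivity the recovery of
  \<open>a\<close> by division.\<close>

lemma rep_count_eq_1_iff_tiles:
  assumes pos: "\<forall>i\<in>{1..m}. lam i \<ge> 1" and inj: "inj_on lam {1..m}"
  shows "(\<forall>n. rep_count A m lam n = 1) \<longleftrightarrow> tiles (lam ` {1..m}) (\<lambda>l. (*) l ` A)"
proof -
  let ?I = "{1..m}"
  define \<phi> where "\<phi> a = (\<lambda>l\<in>lam ` ?I. l * a (inv_into ?I lam l))" for a :: "nat \<Rightarrow> nat"
  define \<psi> where "\<psi> f = (\<lambda>i\<in>?I. f (lam i) div lam i)" for f :: "nat \<Rightarrow> nat"
  have \<phi>: "\<phi> a (lam i) = lam i * a i" if "i \<in> ?I" for a i
    using that inj by (simp add: \<phi>_def)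
  have bij: "bij_betw \<phi> (?I \<rightarrow>\<^sub>E A) (\<Pi>\<^sub>E l\<in>lam ` ?I. (*) l ` A)"
  proof (rule bij_betw_byWitness[where f' = \<psi>])
    show "\<forall>a\<in>?I \<rightarrow>\<^sub>E A. \<psi> (\<phi> a) = a"
    proof (intro ballI ext)
      fix a i
      assume a: "a \<in> ?I \<rightarrow>\<^sub>E A"
      show "\<psi> (\<phi> a) i = a i"
      proof (cases "i \<in> ?I")
        case True
        then have "lam i > 0"
          using pos by fastforce
        then show ?thesis
          using \<phi>[OF True] True by (simp add: \<psi>_def)
      next
        case False
        then show ?thesis
          using a by (auto simp: \<psi>_def PiE_def extensional_def)
      qed
    qed
    show "\<forall>f\<in>\<Pi>\<^sub>E l\<in>lam ` ?I. (*) l ` A. \<phi> (\<psi> f) = f"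
    proof (intro ballI ext)
      fix f l
      assume f: "f \<in> (\<Pi>\<^sub>E l\<in>lam ` ?I. (*) l ` A)"
      show "\<phi> (\<psi> f) l = f l"
      proof (cases "l \<in> lam ` ?I")
        case True
        then obtain i where i: "i \<in> ?I" "l = lam i"
          by blast
        then have "lam i dvd f (lam i)"
          using f True by (metis PiE_mem dvd_triv_left imageE)
        then show ?thesis
          using \<phi>[OF i(1)] i by (simp add: \<psi>_def)
      next
        case False
        then show ?thesis
          using f by (auto simp: \<phi>_def PiE_def extensional_def)
      qed
    qed
    show "\<phi> ` (?I \<rightarrow>\<^sub>E A) \<subseteq> (\<Pi>\<^sub>E l\<in>lam ` ?I. (*) l ` A)"
    proof (intro image_subsetI PiE_I)
      fix a l
      assume a: "a \<in> ?I \<rightarrow>\<^sub>E A" and "l \<in> lam ` ?I"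
      then obtain i where i: "i \<in> ?I" "l = lam i"
        by blast
      then have "a i \<in> A"
        using a by (metis PiE_mem)
      then show "\<phi> a l \<in> (*) l ` A"
        unfolding i(2) \<phi>[OF i(1)] by (rule imageI)
    qed (simp add: \<phi>_def)
    show "\<psi> ` (\<Pi>\<^sub>E l\<in>lam ` ?I. (*) l ` A) \<subseteq> (?I \<rightarrow>\<^sub>E A)"
    proof (intro image_subsetI PiE_I)
      fix f i
      assume f: "f \<in> (\<Pi>\<^sub>E l\<in>lam ` ?I. (*) l ` A)" and i: "i \<in> ?I"
      then have "f (lam i) \<in> (*) (lam i) ` A"
        by (metis PiE_mem imageI)
      moreover have "lam i > 0"
        using pos i by fastforce
      ultimately show "\<psi> f i \<in> A"
        using i by (auto simp: \<psi>_def)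
    qed (auto simp: \<psi>_def)
  qed
  have sum_\<phi>: "sum (\<phi> a) (lam ` ?I) = (\<Sum>i=1..m. lam i * a i)" for a
    unfolding sum.reindex[OF inj] by (rule sum.cong) (simp_all add: \<phi>)
  have "rep_count A m lam n = 1 \<longleftrightarrow> (\<exists>!f. f \<in> (\<Pi>\<^sub>E l\<in>lam ` ?I. (*) l ` A) \<and> sum f (lam ` ?I) = n)" for n
    unfolding rep_count_def sum_\<phi>[symmetric] card_eq_1_iff_ex1 mem_Collect_eq
    by (rule ex1_bij_betw[OF bij])
  then show ?thesis
    unfolding tiles_def by (rule all_cong1)
qed

section \<open>Complementary pairs with a finite part\<close>

definition blow :: "nat \<Rightarrow> nat set \<Rightarrow> nat set" where
  "blow p X = {c + p * x | c x. c < p \<and> x \<in> X}"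

lemma mem_blow:
  assumes "p > 0"
  shows "n \<in> blow p X \<longleftrightarrow> n div p \<in> X"
proof
  assume "n \<in> blow p X"
  then show "n div p \<in> X"
    unfolding blow_def by auto
next
  assume "n div p \<in> X"
  moreover have "n = n mod p + p * (n div p)" "n mod p < p"
    using assms by simp_all
  ultimately show "n \<in> blow p X"
    unfolding blow_def by blast
qed

text \<open>Division with remainder by \<open>p\<close>: the pair splits the quotient, and the
  remainder goes to the side with the blocks. This undoes the peeling in
  \<open>complementary_cases\<close>.\<close>

lemma complementary_blow:
  assumes XY: "complementary X Y" and p: "p > 0"
  shows "complementary (blow p X) ((*) p ` Y)"
  unfolding complementary_def
proof (intro conjI allI ballI impI)
  fix n
  obtain x y where xy: "x \<in> X" "y \<in> Y" "n div p = x + y"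
    by (rule complementaryE[OF XY])
  have "n mod p + p * x \<in> blow p X"
    using p xy(1) by (simp add: mem_blow)
  moreover have "n = n mod p + p * x + p * y"
    by (metis add.assoc add.commute distrib_left mult_div_mod_eq xy(3))
  ultimately show "\<exists>x\<in>blow p X. \<exists>y\<in>(*) p ` Y. n = x + y"
    using xy(2) by blast
next
  fix x x' y y'
  assume x: "x \<in> blow p X" "x' \<in> blow p X" and y: "y \<in> (*) p ` Y" "y' \<in> (*) p ` Y"
    and eq: "x + y = x' + y'"
  obtain z z' where z: "z \<in> Y" "z' \<in> Y" "y = p * z" "y' = p * z'"
    using y by blast
  have "x div p + z = (x + y) div p" "x' div p + z' = (x' + y') div p"
    using p z by simp_all
  then have "x div p + z = x' div p + z'"
    unfolding eq by simp
  moreover have "x div p \<in> X" "x' div p \<in> X"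
    using x unfolding mem_blow[OF p] .
  ultimately have "z = z'"
    using complementary_unique(2)[OF XY _ _ z(1,2)] by blast
  then show "x = x'"
    using eq z by simp
qed

lemma complementary_zero_imp_UNIV:
  assumes "complementary X {0}"
  shows "X = UNIV"
proof -
  have "n \<in> X" for n
  proof -
    obtain x y where "x \<in> X" "y \<in> {0}" "n = x + y"
      by (rule complementaryE[OF assms])
    then show ?thesis
      by simp
  qed
  then show ?thesis
    by blast
qed

text \<open>The block length \<open>p\<close> is the least positive element of \<open>Y\<close>.
  Division by \<open>p\<close> turns it into 1, so 1 is in \<open>Y'\<close> and the next peeling
  applies with the roles exchanged.\<close>

lemma complementary_cases:
  assumes XY: "complementary X Y" and one: "1 \<in> X" and ne: "Y \<noteq> {0}"
  obtains p X' Y' where "p \<ge> 2" "X = blow p X'" "Y = (*) p ` Y'" "complementary X' Y'" "1 \<in> Y'"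
proof -
  have "\<exists>y\<in>Y. y \<noteq> 0"
    using ne complementary_zero(2)[OF XY] by blast
  then have ex: "\<exists>y. y \<in> Y \<and> 0 < y"
    by auto
  define g where "g = (LEAST y. y \<in> Y \<and> 0 < y)"
  have g: "g \<in> Y" "0 < g"
    unfolding g_def using LeastI_ex[OF ex] by blast+
  have min: "g \<le> y" if "y \<in> Y" "0 < y" for y
    unfolding g_def using that by (simp add: Least_le)
  have dvd: "g dvd y" if "y \<in> Y" for y
    by (rule complementary_blocks(1)[OF XY g min that])
  have blocks: "x \<in> X \<longleftrightarrow> g * (x div g) \<in> X" for x
    by (rule complementary_blocks(2)[OF XY g min])
  have "g \<noteq> 1"
    using complementary_disjoint[OF XY one] g(1) by (metis one_neq_zero)
  then have "g \<ge> 2"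
    using g(2) by simp
  moreover have "X = blow g {x. g * x \<in> X}"
    unfolding set_eq_iff mem_blow[OF g(2)] mem_Collect_eq by (intro allI blocks)
  moreover have "Y = (*) g ` {y. g * y \<in> Y}"
    using dvd by (blast elim: dvdE)
  moreover have "complementary {x. g * x \<in> X} {y. g * y \<in> Y}"
    by (rule complementary_quotient[OF XY g(2) dvd])
  ultimately show ?thesis
    by (rule that) (use g(1) in simp)
qed

section \<open>Recursions for S and T in the parameter list\<close>

lemma partial_prod_0: "partial_prod w 0 = 1"
  by (simp add: partial_prod_def)

lemma partial_prod_Suc_shift: "partial_prod w (Suc i) = w 1 * partial_prod (\<lambda>j. w (Suc j)) i"
proof -
  have "partial_prod w (Suc i) = w 1 * (\<Prod>j=Suc 1..Suc i. w j)"
    unfolding partial_prod_def by (rule prod.atLeast_Suc_atMost) simp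
  also have "(\<Prod>j=Suc 1..Suc i. w j) = (\<Prod>j=1..i. w (Suc j))"
    by (rule prod.shift_bounds_cl_Suc_ivl)
  finally show ?thesis
    by (simp add: partial_prod_def)
qed

lemma partial_prod_upd_0: "partial_prod (w(0 := x)) i = partial_prod w i"
  unfolding partial_prod_def by (rule prod.cong) auto

lemma S_set_upd_0: "S_set k (u(0 := x)) (v(0 := y)) = S_set k u v"
  unfolding S_set_def by (simp add: partial_prod_upd_0)

lemma T_set_upd_0: "T_set k (u(0 := x)) (v(0 := y)) = T_set k u v"
  unfolding T_set_def by (simp add: partial_prod_upd_0)

lemma S_set_0: "S_set 0 u v = {0}"
  by (simp add: S_set_def)

text \<open>All terms with \<open>h > 0\<close> share the factor \<open>u 1 * v 1\<close>; taking it
  out leaves the same sum for the shifted parameters.\<close>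

lemma S_set_Suc:
  "S_set (Suc k) u v = blow (u 1) ((*) (v 1) ` S_set k (\<lambda>j. u (Suc j)) (\<lambda>j. v (Suc j)))"
  (is "_ = blow _ (_ ` S_set k ?u ?v)")
proof -
  have sum: "(\<Sum>h<Suc k. c h * partial_prod u h * partial_prod v h) =
      c 0 + u 1 * (v 1 * (\<Sum>h<k. c (Suc h) * partial_prod ?u h * partial_prod ?v h))" for c
    unfolding sum.lessThan_Suc_shift
    by (simp add: partial_prod_0 partial_prod_Suc_shift sum_distrib_left ac_simps)
  show ?thesis
  proof (intro equalityI subsetI)
    fix x
    assume "x \<in> S_set (Suc k) u v"
    then obtain c where c: "\<forall>h<Suc k. c h < u (h + 1)"
      and x: "x = (\<Sum>h<Suc k. c h * partial_prod u h * partial_prod v h)"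
      unfolding S_set_def by blast
    have "(\<Sum>h<k. c (Suc h) * partial_prod ?u h * partial_prod ?v h) \<in> S_set k ?u ?v"
      unfolding S_set_def using c by (intro CollectI exI[of _ "\<lambda>h. c (Suc h)"]) simp
    then show "x \<in> blow (u 1) ((*) (v 1) ` S_set k ?u ?v)"
      unfolding x sum blow_def using c by auto
  next
    fix x
    assume "x \<in> blow (u 1) ((*) (v 1) ` S_set k ?u ?v)"
    then obtain a s where a: "a < u 1" and s: "s \<in> S_set k ?u ?v" and x: "x = a + u 1 * (v 1 * s)"
      unfolding blow_def by blast
    obtain c where c: "\<forall>h<k. c h < ?u (h + 1)"
      and s: "s = (\<Sum>h<k. c h * partial_prod ?u h * partial_prod ?v h)"
      using s unfolding S_set_def by blast
    let ?c = "case_nat a c"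
    have "x = (\<Sum>h<Suc k. ?c h * partial_prod u h * partial_prod v h)"
      unfolding sum x s by simp
    moreover have "\<forall>h<Suc k. ?c h < u (h + 1)"
      using a c by (auto split: nat.split)
    ultimately show "x \<in> S_set (Suc k) u v"
      unfolding S_set_def by blast
  qed
qed

lemma T_set_1: "T_set (Suc 0) u v = (*) (u 1) ` UNIV"
proof -
  have "T_set (Suc 0) u v = {c 0 * u 1 | c :: nat \<Rightarrow> nat. True}"
    by (simp add: T_set_def partial_prod_0 partial_prod_Suc_shift)
  also have "\<dots> = (*) (u 1) ` UNIV"
  proof (intro equalityI subsetI)
    fix x
    assume "x \<in> (*) (u 1) ` UNIV"
    then obtain y where "x = y * u 1"
      by (auto simp: mult.commute)
    then show "x \<in> {c 0 * u 1 | c :: nat \<Rightarrow> nat. True}"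
      by (intro CollectI exI[of _ "\<lambda>_. y"]) simp
  qed (auto simp: mult.commute)
  finally show ?thesis .
qed

text \<open>With at least two levels the lowest digit is bounded by \<open>v 1\<close>; with one
  level it is the unrestricted last digit, as in \<open>T_set_1\<close>.\<close>

lemma T_set_Suc:
  "T_set (Suc (Suc k)) u v =
     (*) (u 1) ` blow (v 1) (T_set (Suc k) (\<lambda>j. u (Suc j)) (\<lambda>j. v (Suc j)))"
  (is "_ = _ ` blow _ (T_set _ ?u ?v)")
proof -
  have sum: "(\<Sum>h<Suc (Suc k). c h * partial_prod u (h + 1) * partial_prod v h) =
      u 1 * (c 0 + v 1 * (\<Sum>h<Suc k. c (Suc h) * partial_prod ?u (h + 1) * partial_prod ?v h))" for c
    unfolding sum.lessThan_Suc_shift[of _ "Suc k"] sum_distrib_left distrib_left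
    by (simp add: partial_prod_0 partial_prod_Suc_shift[of _ "_ :: nat"] sum_distrib_left ac_simps del: sum.lessThan_Suc)
  show ?thesis
  proof (intro equalityI subsetI)
    fix x
    assume "x \<in> T_set (Suc (Suc k)) u v"
    then obtain c where c: "\<forall>h. h + 1 < Suc (Suc k) \<longrightarrow> c h < v (h + 1)"
      and x: "x = (\<Sum>h<Suc (Suc k). c h * partial_prod u (h + 1) * partial_prod v h)"
      unfolding T_set_def by blast
    have "(\<Sum>h<Suc k. c (Suc h) * partial_prod ?u (h + 1) * partial_prod ?v h) \<in> T_set (Suc k) ?u ?v"
      unfolding T_set_def using c by (intro CollectI exI[of _ "\<lambda>h. c (Suc h)"]) simp
    moreover have "c 0 < v 1"
      using c by simp
    ultimately show "x \<in> (*) (u 1) ` blow (v 1) (T_set (Suc k) ?u ?v)"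
      unfolding x sum blow_def by blast
  next
    fix x
    assume "x \<in> (*) (u 1) ` blow (v 1) (T_set (Suc k) ?u ?v)"
    then obtain a s where a: "a < v 1" and s: "s \<in> T_set (Suc k) ?u ?v" and x: "x = u 1 * (a + v 1 * s)"
      unfolding blow_def by blast
    obtain c where c: "\<forall>h. h + 1 < Suc k \<longrightarrow> c h < ?v (h + 1)"
      and s: "s = (\<Sum>h<Suc k. c h * partial_prod ?u (h + 1) * partial_prod ?v h)"
      using s unfolding T_set_def by blast
    let ?c = "case_nat a c"
    have "x = (\<Sum>h<Suc (Suc k). ?c h * partial_prod u (h + 1) * partial_prod v h)"
      unfolding sum x s by simp
    moreover have "\<forall>h. h + 1 < Suc (Suc k) \<longrightarrow> ?c h < v (h + 1)"
      using a c by (auto split: nat.split)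
    ultimately show "x \<in> T_set (Suc (Suc k)) u v"
      unfolding T_set_def by blast
  qed
qed

text \<open>The base pair arises from \<open>{0}\<close> and \<open>UNIV\<close> by one blow-up.
  Each further level adds two blow-ups with exchanged roles, first by \<open>v 1\<close> on the T
  side, then by \<open>u 1\<close> on the S side.\<close>

lemma S_set_T_set_complementary:
  assumes "\<forall>i\<in>{1..Suc k}. u i > 0" "\<forall>i\<in>{1..<Suc k}. v i > 0"
  shows "complementary (S_set (Suc k) u v) (T_set (Suc k) u v)"
  using assms
proof (induction k arbitrary: u v)
  case 0
  have "complementary {0} UNIV"
    by (auto simp: complementary_def)
  then have "complementary (blow (u 1) {0}) ((*) (u 1) ` UNIV)"
    using 0 by (intro complementary_blow) simp_all
  then show ?case
    unfolding T_set_1 S_set_Suc S_set_0 by simp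
next
  case (Suc k)
  let ?S = "S_set (Suc k) (\<lambda>j. u (Suc j)) (\<lambda>j. v (Suc j))"
  let ?T = "T_set (Suc k) (\<lambda>j. u (Suc j)) (\<lambda>j. v (Suc j))"
  have pos: "u 1 > 0" "v 1 > 0"
    using Suc.prems by simp_all
  have "complementary ?S ?T"
    using Suc.prems by (intro Suc.IH) auto
  then have "complementary (blow (v 1) ?T) ((*) (v 1) ` ?S)"
    by (rule complementary_blow[OF complementary_sym pos(2)])
  then have "complementary (blow (u 1) ((*) (v 1) ` ?S)) ((*) (u 1) ` blow (v 1) ?T)"
    by (rule complementary_blow[OF complementary_sym pos(1)])
  then show ?case
    unfolding T_set_Suc S_set_Suc[of "Suc k"] .
qed

text \<open>Each round peels \<open>p\<close> off \<open>S\<close> and, unless only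
  \<open>{0}\<close> remains there, \<open>q\<close> off \<open>T\<close>. The induction on
  \<open>card S\<close> ends because \<open>S\<close> is finite.\<close>

lemma complementary_eq_S_set_T_set:
  assumes "complementary S T" "finite S" "1 \<in> S"
  obtains k u v where "k \<ge> 1" "\<forall>i\<in>{1..k}. u i \<ge> 2" "\<forall>i\<in>{1..<k}. v i \<ge> 2"
    "S = S_set k u v" "T = T_set k u v"
  using assms
proof (induction "card S" arbitrary: S T thesis rule: less_induct)
  case less
  have "T \<noteq> {0}"
  proof
    assume "T = {0}"
    then have "S = UNIV"
      using complementary_zero_imp_UNIV less.prems(2) by blast
    then show False
      using less.prems(3) by simp
  qed
  then obtain p S1 T1 where p: "p \<ge> 2" and S: "S = blow p S1" and T: "T = (*) p ` T1"
    and c1: "complementary S1 T1" and one: "1 \<in> T1"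
    using complementary_cases[OF less.prems(2,4)] by metis
  show ?case
  proof (cases "S1 = {0}")
    case True
    have "T1 = UNIV"
      using complementary_zero_imp_UNIV complementary_sym[OF c1] True by blast
    then have "T = T_set (Suc 0) (\<lambda>_. p) (\<lambda>_. p)"
      unfolding T T_set_1 by simp
    moreover have "S = S_set (Suc 0) (\<lambda>_. p) (\<lambda>_. p)"
      unfolding S True S_set_Suc S_set_0 by simp
    ultimately show ?thesis
      using less.prems(1)[of "Suc 0" "\<lambda>_. p" "\<lambda>_. p"] p by simp
  next
    case False
    then obtain q T2 S2 where q: "q \<ge> 2" and T1: "T1 = blow q T2" and S1: "S1 = (*) q ` S2"
      and c2: "complementary T2 S2" and one2: "1 \<in> S2"
      using complementary_cases[OF complementary_sym[OF c1] one] by metis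
    let ?f = "\<lambda>s. p * (q * s)"
    \<comment> \<open>Multiplication by \<open>p * q\<close> embeds \<open>S2\<close> into
      \<open>S\<close> and misses 1, so the cardinality drops.\<close>
    have sub: "?f ` S2 \<subseteq> S"
    proof (intro image_subsetI)
      fix s
      assume s: "s \<in> S2"
      have "p > 0" "p * (q * s) div p = q * s"
        using p by simp_all
      then show "p * (q * s) \<in> S"
        unfolding S S1 using s by (simp only: mem_blow imageI)
    qed
    moreover have "1 \<notin> ?f ` S2"
      using p by auto
    ultimately have "?f ` S2 \<subset> S"
      using less.prems(4) by blast
    then have "card (?f ` S2) < card S"
      using less.prems(3) by (rule psubset_card_mono[rotated])
    moreover have inj: "inj_on ?f S2"
      using p q by (intro inj_onI) simp
    ultimately have card: "card S2 < card S"
      by (simp add: card_image)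
    have fin: "finite S2"
      using sub less.prems(3) inj by (metis finite_imageD finite_subset)
    obtain k u v where k: "k \<ge> 1" and u: "\<forall>i\<in>{1..k}. u i \<ge> 2" and v: "\<forall>i\<in>{1..<k}. v i \<ge> 2"
      and S2: "S2 = S_set k u v" and T2: "T2 = T_set k u v"
      using less.hyps[OF card _ complementary_sym[OF c2] fin one2] by metis
    \<comment> \<open>The new parameters enter at index 1 and the old ones move up by one. Shifting
      back gives \<open>u(0 := p)\<close> and \<open>v(0 := q)\<close>, which yield the same sets as
      \<open>u\<close> and \<open>v\<close>.\<close>
    define u' where "u' = case_nat 0 (u(0 := p))"
    define v' where "v' = case_nat 0 (v(0 := q))"
    have u': "u' 1 = p" "(\<lambda>j. u' (Suc j)) = u(0 := p)" and v': "v' 1 = q" "(\<lambda>j. v' (Suc j)) = v(0 := q)"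
      by (auto simp: u'_def v'_def)
    obtain k' where k': "k = Suc k'"
      using k by (cases k) auto
    have "S = S_set (Suc k) u' v'"
      unfolding S_set_Suc u' v' S_set_upd_0 S S1 S2 ..
    moreover have "T = T_set (Suc k) u' v'"
      unfolding k' T_set_Suc u' v' T_set_upd_0 T T1 T2 ..
    moreover have "\<forall>i\<in>{1..Suc k}. u' i \<ge> 2" "\<forall>i\<in>{1..<Suc k}. v' i \<ge> 2"
      using u v p q by (auto simp: u'_def v'_def split: nat.split)
    ultimately show ?thesis
      using less.prems(1)[of "Suc k"] by simp
  qed
qed

section \<open>Characterization of unique representability\<close>

theorem theorem1p1:
  fixes m :: nat and lam :: "nat \<Rightarrow> nat" and \<Lambda> A :: "nat set"
  assumes "m \<ge> 1"
    and "\<forall>i\<in>{1..m}. lam i \<ge> 1"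
    and "strict_mono_on {1..m} lam"
    and "\<Lambda> = lam ` {1..m}"
    and "A \<subset> UNIV"
  shows "(\<forall>n. rep_count A m lam n = 1) \<longleftrightarrow>
    (\<exists>l k u v. l \<ge> 2 \<and> k \<ge> 1 \<and>
       (\<forall>i\<in>{1..k}. u i \<ge> 2) \<and> (\<forall>i\<in>{1..<k}. v i \<ge> 2) \<and>
       \<Lambda> = Lambda_set l k u v \<and> A = A_set l k u v)"
proof -
  have rep: "(\<forall>n. rep_count A m lam n = 1) \<longleftrightarrow> tiles \<Lambda> (\<lambda>l. (*) l ` A)"
    unfolding assms(4) using rep_count_eq_1_iff_tiles[OF assms(2)] assms(3) strict_mono_on_imp_inj_on by blast
  have fin: "finite \<Lambda>"
    using assms(4) by simp
  show ?thesis
    unfolding rep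
  proof
    assume tiles: "tiles \<Lambda> (\<lambda>l. (*) l ` A)"
    interpret unit_representation \<Lambda> A
    proof
      show "l > 0" if "l \<in> \<Lambda>" for l
        using that assms(2) unfolding assms(4) by fastforce
    qed (use fin tiles assms(5) in blast)+
    obtain b where b: "b > 1" "b \<in> \<Lambda>" "{..<b} \<subseteq> A"
      "\<forall>l\<in>\<Lambda> - {1}. \<forall>x\<in>(*) l ` A. b dvd x" "\<forall>x. x \<in> A \<longleftrightarrow> b * (x div b) \<in> A"
      by (rule base_exists)
    interpret unit_representation_base \<Lambda> A b
      by unfold_locales (rule b)+
    have "inj ((^) b)"
      using b(1) by (simp add: inj_on_def)
    moreover have "(^) b ` {s. b ^ s \<in> \<Lambda>} \<subseteq> \<Lambda>"
      by blast
    ultimately have "finite {s. b ^ s \<in> \<Lambda>}"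
      using fin by (metis finite_imageD finite_subset inj_on_subset subset_UNIV)
    moreover have "1 \<in> {s. b ^ s \<in> \<Lambda>}"
      using b(2) by simp
    ultimately obtain k u v where k: "k \<ge> 1" "\<forall>i\<in>{1..k}. u i \<ge> 2" "\<forall>i\<in>{1..<k}. v i \<ge> 2"
      and S: "{s. b ^ s \<in> \<Lambda>} = S_set k u v" and T: "{t. b ^ t \<in> A} = T_set k u v"
      by (rule complementary_eq_S_set_T_set[OF exponents_complementary])
    have "\<Lambda> = Lambda_set b k u v"
      unfolding Lambda_set_def S[symmetric] using member_power by blast
    moreover have "A = A_set b k u v"
      unfolding A_set_eq_digit_set[OF b(1)] T[symmetric] by (rule A_eq_digit_set)
    ultimately show "\<exists>l k u v. l \<ge> 2 \<and> k \<ge> 1 \<and>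
       (\<forall>i\<in>{1..k}. u i \<ge> 2) \<and> (\<forall>i\<in>{1..<k}. v i \<ge> 2) \<and>
       \<Lambda> = Lambda_set l k u v \<and> A = A_set l k u v"
      using b(1) k by (intro exI[of _ b] exI[of _ k] exI[of _ u] exI[of _ v]) simp
  next
    assume "\<exists>l k u v. l \<ge> 2 \<and> k \<ge> 1 \<and>
       (\<forall>i\<in>{1..k}. u i \<ge> 2) \<and> (\<forall>i\<in>{1..<k}. v i \<ge> 2) \<and>
       \<Lambda> = Lambda_set l k u v \<and> A = A_set l k u v"
    then obtain b k u v where b: "b \<ge> 2" and k: "k \<ge> 1"
      and u: "\<forall>i\<in>{1..k}. u i \<ge> 2" and v: "\<forall>i\<in>{1..<k}. v i \<ge> 2"
      and \<Lambda>: "\<Lambda> = Lambda_set b k u v" and A: "A = A_set b k u v"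
      by blast
    have \<Lambda>S: "\<Lambda> = (^) b ` S_set k u v"
      unfolding \<Lambda> Lambda_set_def by blast
    obtain k' where "k = Suc k'"
      using k by (cases k) auto
    moreover have "\<forall>i\<in>{1..k}. u i > 0" "\<forall>i\<in>{1..<k}. v i > 0"
      using u v by fastforce+
    ultimately have "complementary (S_set k u v) (T_set k u v)"
      using S_set_T_set_complementary by blast
    \<comment> \<open>Finiteness of the exponent set is read off from \<Lambda>, into which it
      embeds by taking powers.\<close>
    moreover have "inj_on ((^) b) (S_set k u v)"
      using b by (simp add: inj_on_def)
    then have "finite (S_set k u v)"
      using fin unfolding \<Lambda>S by (rule finite_imageD[rotated])
    moreover have "b > 1"
      using b by simp
    ultimately show "tiles \<Lambda> (\<lambda>l. (*) l ` A)"
      unfolding \<Lambda>S A by (simp only: tiles_powers_digit_set A_set_eq_digit_set)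
  qed
qed

end
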